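(* Let $\beta\in(1/2,1)$ and let $(\mathcal{T}_n)_{n\ge1}$ be the recursive trees with limited memory in the mesoscopic regime, $j(n)=n-\lfloor n^\beta\rfloor$. For any $k\ge1$, let $\mathcal{T}_n^{(k)}$ be the subtree of $\mathcal{T}_n$ spanned by the root $1$ and the vertices $n,n-1,\dots,n-k+1$. Then, as $n\to\infty$, $$\frac{1-\beta}{2}\,n^{-(1-\beta)}\,\mathcal{T}_n^{(k)}\longrightarrow S_k\quad\text{in probability}$$ in the Gromov--Hausdorff topology, where $S_k$ is a star graph with $k$ legs of length $1$ (i.e. $k$ line segments of length $1$ glued together at one common endpoint).
   Context: **Model.** $\mathcal{T}_1$ is the tree with the single vertex $1$ (the root of all the trees) and no edges. Given $\mathcal{T}_n$ (vertex set $\{1,\dots,n\}$), $\mathcal{T}_{n+1}$ is obtained by adding vertex $n+1$ and an edge between $n+1$ and a vertex chosen uniformly at random, independently of the past, from $\{v\in\{1,\dots,n\}: j(n)\le v\le n\}$. Mesoscopic regime: $j(n)=n-\lfloor n^\beta\rfloor$. For a tree $T$ and $c>0$, $cT$ denotes the metric space of $T$ with its graph distance multiplied by $c$. *)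

theory Defs
  imports "HOL-Probability.Probability"
begin

section \<open>Graphs\<close>

text \<open>A graph is a set of vertices together with a symmetric adjacency relation.\<close>

type_synonym 'v ugraph = "'v set \<times> ('v \<times> 'v) set"

definition induced_subgraph :: "'v ugraph \<Rightarrow> 'v set \<Rightarrow> 'v ugraph" where
  "induced_subgraph G S = (S, snd G \<inter> S \<times> S)"

definition connected_graph :: "'v ugraph \<Rightarrow> bool" where
  "connected_graph G \<longleftrightarrow> fst G \<noteq> {} \<and> (\<forall>u\<in>fst G. \<forall>v\<in>fst G. (u, v) \<in> (snd G)\<^sup>*)"

text \<open>\<open>(u, v) \<in> E ^^ l\<close> says that there is a walk of length \<open>l\<close> from \<open>u\<close> to \<open>v\<close>.
  The value is meaningful only when \<open>u\<close> and \<open>v\<close> are connected.\<close>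

definition graph_dist :: "'v ugraph \<Rightarrow> 'v \<Rightarrow> 'v \<Rightarrow> nat" where
  "graph_dist G u v = (LEAST l. (u, v) \<in> snd G ^^ l)"

text \<open>The smallest subtree of the tree \<open>T\<close> that contains \<open>A\<close>; in a tree, an intersection of
  connected vertex sets with a common point is connected.\<close>

definition spanned_subtree :: "'v ugraph \<Rightarrow> 'v set \<Rightarrow> 'v ugraph" where
  "spanned_subtree T A = induced_subgraph T
     (\<Inter>{S. A \<subseteq> S \<and> S \<subseteq> fst T \<and> connected_graph (induced_subgraph T S)})"


section \<open>Recursive trees with limited memory\<close>

definition attach_leaf :: "'v ugraph \<Rightarrow> 'v \<Rightarrow> 'v \<Rightarrow> 'v ugraph" where
  "attach_leaf G u v = (insert u (fst G), snd G \<union> {(u, v), (v, u)})"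

text \<open>\<open>p n\<close> is the vertex to which vertex \<open>n + 1\<close> is attached. The tree of size \<open>0\<close> is a dummy.\<close>

fun recursive_tree :: "(nat \<Rightarrow> nat) \<Rightarrow> nat \<Rightarrow> nat ugraph" where
  "recursive_tree p 0 = ({}, {})"
| "recursive_tree p (Suc 0) = ({1}, {})"
| "recursive_tree p (Suc (Suc n)) =
     attach_leaf (recursive_tree p (Suc n)) (Suc (Suc n)) (p (Suc n))"

locale limited_memory_process = prob_space M for M :: "'a measure" +
  fixes j :: "nat \<Rightarrow> nat" and p :: "nat \<Rightarrow> 'a \<Rightarrow> nat"
  assumes indep_choices: "indep_vars (\<lambda>_. count_space UNIV) p {1..}"
    and uniform_choices: "\<And>n. n \<ge> 1 \<Longrightarrow>
      distr M (count_space UNIV) (p n) = measure_pmf (pmf_of_set {v \<in> {1..n}. j n \<le> v \<and> v \<le> n})"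

text \<open>For \<open>\<beta> \<le> 1\<close> and \<open>n \<ge> 1\<close> the subtraction does not truncate.\<close>

definition mesoscopic :: "real \<Rightarrow> nat \<Rightarrow> nat" where
  "mesoscopic \<beta> n = n - nat \<lfloor>real n powr \<beta>\<rfloor>"


section \<open>Metric spaces and the Gromov--Hausdorff distance\<close>

text \<open>A carrier set and a distance function, as in the locale \<^locale>\<open>Metric_space\<close>.\<close>

type_synonym 'b mspace_pair = "'b set \<times> ('b \<Rightarrow> 'b \<Rightarrow> real)"

definition scaled_graph_space :: "real \<Rightarrow> 'v ugraph \<Rightarrow> 'v mspace_pair" where
  "scaled_graph_space c G = (fst G, \<lambda>u v. c * real (graph_dist G u v))"

text \<open>The point \<open>(i, t)\<close> with \<open>1 \<le> i \<le> k\<close> and \<open>0 < t \<le> 1\<close> lies on leg \<open>i\<close> at distance \<open>t\<close> from the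
  centre, and \<open>(0, 0)\<close> is the centre. The distance is the length of the shortest path in the star;
  the absolute values in its second case only matter off the carrier.\<close>

definition star_space :: "nat \<Rightarrow> (nat \<times> real) mspace_pair" where
  "star_space k =
     (insert (0, 0) ({1..k} \<times> {0<..1}),
      \<lambda>x y. if fst x = fst y then \<bar>snd x - snd y\<bar> else \<bar>snd x\<bar> + \<bar>snd y\<bar>)"

lemma Metric_space_star: "Metric_space (fst (star_space k)) (snd (star_space k))"
  by unfold_locales (auto simp: star_space_def split: if_splits)

definition hausdorff_dist :: "('z \<Rightarrow> 'z \<Rightarrow> real) \<Rightarrow> 'z set \<Rightarrow> 'z set \<Rightarrow> ennreal" where
  "hausdorff_dist d A B =
     max (SUP a\<in>A. INF b\<in>B. ennreal (d a b)) (SUP b\<in>B. INF a\<in>A. ennreal (d a b))"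

definition isometric_embedding ::
    "'b mspace_pair \<Rightarrow> 'z mspace_pair \<Rightarrow> ('b \<Rightarrow> 'z) \<Rightarrow> bool" where
  "isometric_embedding X Z f \<longleftrightarrow>
     f ` fst X \<subseteq> fst Z \<and> (\<forall>x\<in>fst X. \<forall>y\<in>fst X. snd Z (f x) (f y) = snd X x y)"

text \<open>The infimum of the Hausdorff distances between isometric copies of \<open>X\<close> and \<open>Y\<close> in a common
  metric space \<open>Z\<close>. Nothing is lost by taking the points of \<open>Z\<close> from the sum type: only the points
  of the two copies matter, and the union of the copies injects into \<open>'b + 'c\<close>.\<close>

definition gromov_hausdorff_dist :: "'b mspace_pair \<Rightarrow> 'c mspace_pair \<Rightarrow> ennreal" where
  "gromov_hausdorff_dist X Y =
     Inf {hausdorff_dist (snd Z) (f ` fst X) (g ` fst Y) | (Z :: ('b + 'c) mspace_pair) f g.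
            Metric_space (fst Z) (snd Z) \<and> isometric_embedding X Z f \<and> isometric_embedding Y Z g}"

text \<open>Convergence in probability to a deterministic space. Measurability of the distance is part of
  the definition, because the measure of a non-measurable set is \<open>0\<close> by convention.\<close>

definition GH_tendsto_in_prob ::
    "'a measure \<Rightarrow> (nat \<Rightarrow> 'a \<Rightarrow> 'b mspace_pair) \<Rightarrow> 'c mspace_pair \<Rightarrow> bool" where
  "GH_tendsto_in_prob M X Y \<longleftrightarrow>
     (\<forall>n. (\<lambda>\<omega>. gromov_hausdorff_dist (X n \<omega>) Y) \<in> borel_measurable M) \<and>
     (\<forall>\<epsilon>::real. \<epsilon> > 0 \<longrightarrow>
       (\<lambda>n. measure M {\<omega> \<in> space M. gromov_hausdorff_dist (X n \<omega>) Y > ennreal \<epsilon>}) \<longlonglongrightarrow> 0)"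

end

theory Submission
  imports Defs "HOL-Real_Asymp.Real_Asymp"
begin

text \<open>Why the rescaled subtree becomes a star.

  A vertex near \<open>x\<close> chooses its parent almost uniformly among the last \<open>x powr \<beta>\<close> vertices, so one step
  towards the root lowers the label by about \<open>x powr \<beta> / 2\<close>. The number of steps from \<open>n\<close> down to the root
  is therefore close to the integral of \<open>2 * x powr (- \<beta>)\<close> over \<open>{0..n}\<close>, that is to
  \<open>g n = 2 / (1 - \<beta>) * n powr (1 - \<beta>)\<close>, called \<open>typical_height \<beta> n\<close> below. The scaling factor of the theorem is
  \<open>1 / g n\<close>. Two facts about the random tree give the star.

  \<^item> Height concentration (\<open>height_concentration\<close>): the height of \<open>v\<close> divided by \<open>g v\<close> tends to 1 in probability.
    Conditioning on the choice of the parent gives \<open>E exp (s * h (m + 1)) = exp s * A\<close>, where \<open>A\<close> is the average of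
    \<open>E exp (s * h v)\<close> over the window of possible parents. The function \<open>exp ((s + \<epsilon> * \<bar>s\<bar>) * g v)\<close> is a
    supersolution of this recursion for large \<open>m\<close> when \<open>s\<close> is small, because \<open>g\<close> grows asymptotically by 1 on average
    over a window (\<open>mean_gain_tendsto\<close>) and by a bounded amount in any case. The Markov inequality then bounds both tails.

  \<^item> Late coalescence (\<open>common_mean_bound\<close>): the expected number of common ancestors of two distinct vertices
    is \<open>o(g n)\<close>. Always move the younger of two lineages. From \<open>m + 1\<close> it hits the other one with probability at most
    \<open>m powr (- \<beta>)\<close>, and then they share at most about \<open>2 * g m\<close> ancestors on average. The product has order
    \<open>m powr (1 - 2 * \<beta>)\<close>, which tends to 0 because \<open>\<beta> > 1 / 2\<close>. A step earns on average at least half a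
    unit of \<open>g\<close>, so that \<open>\<delta> * (g u + g v)\<close> plus a constant dominates the mean number of common ancestors.

  The rest is deterministic. The number of elements in which two lineages differ bounds the distance from below, and walks
  through the root or along a lineage bound it from above. Hence, if the last \<open>k\<close> vertices have height about \<open>g n\<close> and
  few common ancestors, sending each ancestor of the \<open>i\<close>-th of them to its rescaled height on the \<open>i\<close>-th leg gives a
  correspondence with the star of small distortion (\<open>spanned_subtree_close_to_star\<close>). Correspondences of small
  distortion bound the Gromov--Hausdorff distance (\<open>gromov_hausdorff_dist_le_correspondence\<close>).\<close>

section \<open>Correspondences bound the Gromov--Hausdorff distance\<close>

text \<open>The cheapest way from \<open>x\<close> to \<open>y\<close> if one can cross between corresponding points at cost \<open>r\<close>.\<close>

definition correspondence_dist ::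
    "'b mspace_pair \<Rightarrow> 'c mspace_pair \<Rightarrow> ('b \<times> 'c) set \<Rightarrow> real \<Rightarrow> 'b \<Rightarrow> 'c \<Rightarrow> real" where
  "correspondence_dist X Y R r x y = (INF (a, b)\<in>R. snd X x a + r + snd Y b y)"

definition glued_dist ::
    "'b mspace_pair \<Rightarrow> 'c mspace_pair \<Rightarrow> ('b \<times> 'c) set \<Rightarrow> real \<Rightarrow> 'b + 'c \<Rightarrow> 'b + 'c \<Rightarrow> real" where
  "glued_dist X Y R r z w = (case (z, w) of
       (Inl x, Inl x') \<Rightarrow> snd X x x'
     | (Inr y, Inr y') \<Rightarrow> snd Y y y'
     | (Inl x, Inr y) \<Rightarrow> correspondence_dist X Y R r x y
     | (Inr y, Inl x) \<Rightarrow> correspondence_dist X Y R r x y)"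

text \<open>A path between two points of the same space that crosses twice pays \<open>2 * r\<close> for the crossings. This
  makes up for the distortion, so such a detour is never shorter than the given distance; the other cases of
  the triangle inequality follow from those of the two spaces.\<close>

lemma Metric_space_glued:
  assumes X: "Metric_space (fst X) (snd X)" and Y: "Metric_space (fst Y) (snd Y)"
    and R: "R \<subseteq> fst X \<times> fst Y" "R \<noteq> {}" and r: "r > 0"
    and dist: "\<And>a b a' b'. (a, b) \<in> R \<Longrightarrow> (a', b') \<in> R \<Longrightarrow> \<bar>snd X a a' - snd Y b b'\<bar> \<le> 2 * r"
  shows "Metric_space (fst X <+> fst Y) (glued_dist X Y R r)"
proof -
  interpret X: Metric_space "fst X" "snd X" by fact
  interpret Y: Metric_space "fst Y" "snd Y" by fact
  let ?c = "correspondence_dist X Y R r"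
  have bdd: "bdd_below ((\<lambda>(a, b). snd X x a + r + snd Y b y) ` R)" for x y
    by (rule bdd_belowI[of _ 0]) (use r in \<open>auto intro!: add_nonneg_nonneg\<close>)
  have lower: "?c x y \<ge> c" if "\<And>a b. (a, b) \<in> R \<Longrightarrow> c \<le> snd X x a + r + snd Y b y" for x y c
    unfolding correspondence_dist_def using R(2) that by (intro cINF_greatest) auto
  have upper: "?c x y \<le> snd X x a + r + snd Y b y" if "(a, b) \<in> R" for x y a b
    unfolding correspondence_dist_def using cINF_lower[OF bdd that] by simp
  have c_pos: "?c x y > 0" for x y
    using lower[of r x y] r by (force simp: add_increasing2 add_increasing)
  have XXY: "?c x y \<le> snd X x x' + ?c x' y" if "x \<in> fst X" "x' \<in> fst X" for x x' y
  proof -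
    have "?c x y - snd X x x' \<le> ?c x' y"
    proof (rule lower)
      fix a b assume ab: "(a, b) \<in> R"
      then have "snd X x a \<le> snd X x x' + snd X x' a" using R(1) that by (intro X.triangle) auto
      with upper[OF ab, of x y] show "?c x y - snd X x x' \<le> snd X x' a + r + snd Y b y" by simp
    qed
    then show ?thesis by simp
  qed
  have XYY: "?c x y \<le> ?c x y' + snd Y y' y" if "y \<in> fst Y" "y' \<in> fst Y" for x y y'
  proof -
    have "?c x y - snd Y y' y \<le> ?c x y'"
    proof (rule lower)
      fix a b assume ab: "(a, b) \<in> R"
      then have "snd Y b y \<le> snd Y b y' + snd Y y' y" using R(1) that by (intro Y.triangle) auto
      with upper[OF ab, of x y] show "?c x y - snd Y y' y \<le> snd X x a + r + snd Y b y'" by simp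
    qed
    then show ?thesis by simp
  qed
  have XYX: "snd X x x' \<le> ?c x y + ?c x' y"
    if "x \<in> fst X" "x' \<in> fst X" "y \<in> fst Y" for x x' y
  proof -
    have "snd X x x' - ?c x' y \<le> ?c x y"
    proof (rule lower)
      fix a b assume ab: "(a, b) \<in> R"
      have "snd X x x' - (snd X x a + r + snd Y b y) \<le> ?c x' y"
      proof (rule lower)
        fix a' b' assume ab': "(a', b') \<in> R"
        have "snd X x x' \<le> snd X x a + snd X a x'" "snd X a x' \<le> snd X a a' + snd X a' x'"
          using ab ab' R(1) that by (auto intro!: X.triangle)
        moreover have "snd Y b b' \<le> snd Y b y + snd Y y b'"
          using ab ab' R(1) that by (intro Y.triangle) auto
        moreover note dist[OF ab ab'] X.commute[of a' x'] Y.commute[of b' y]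
        ultimately show "snd X x x' - (snd X x a + r + snd Y b y) \<le> snd X x' a' + r + snd Y b' y"
          by linarith
      qed
      then show "snd X x x' - ?c x' y \<le> snd X x a + r + snd Y b y" by linarith
    qed
    then show ?thesis by simp
  qed
  have YXY: "snd Y y y' \<le> ?c x y + ?c x y'"
    if "x \<in> fst X" "y \<in> fst Y" "y' \<in> fst Y" for x y y'
  proof -
    have "snd Y y y' - ?c x y' \<le> ?c x y"
    proof (rule lower)
      fix a b assume ab: "(a, b) \<in> R"
      have "snd Y y y' - (snd X x a + r + snd Y b y) \<le> ?c x y'"
      proof (rule lower)
        fix a' b' assume ab': "(a', b') \<in> R"
        have "snd Y y y' \<le> snd Y y b + snd Y b y'" "snd Y b y' \<le> snd Y b b' + snd Y b' y'"
          using ab ab' R(1) that by (auto intro!: Y.triangle)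
        moreover have "snd X a a' \<le> snd X a x + snd X x a'"
          using ab ab' R(1) that by (intro X.triangle) auto
        moreover note dist[OF ab ab'] X.commute[of a x] Y.commute[of b y]
        ultimately show "snd Y y y' - (snd X x a + r + snd Y b y) \<le> snd X x a' + r + snd Y b' y'"
          by linarith
      qed
      then show "snd Y y y' - ?c x y' \<le> snd X x a + r + snd Y b y" by linarith
    qed
    then show ?thesis by simp
  qed
  show ?thesis
  proof
    fix z w u
    show "0 \<le> glued_dist X Y R r z w"
      using c_pos by (auto simp: glued_dist_def less_imp_le split: sum.split)
    show "glued_dist X Y R r z w = glued_dist X Y R r w z"
      by (auto simp: glued_dist_def X.commute Y.commute split: sum.split)
    show "glued_dist X Y R r z w = 0 \<longleftrightarrow> z = w" if "z \<in> fst X <+> fst Y" "w \<in> fst X <+> fst Y"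
      using that c_pos by (auto simp: glued_dist_def less_imp_neq[THEN not_sym])
    show "glued_dist X Y R r z u \<le> glued_dist X Y R r z w + glued_dist X Y R r w u"
      if "z \<in> fst X <+> fst Y" "w \<in> fst X <+> fst Y" "u \<in> fst X <+> fst Y"
      using that XXY XYY XYX YXY X.triangle Y.triangle
      by (auto simp: glued_dist_def X.commute Y.commute add.commute)
        (metis X.commute Y.commute add.commute)+
  qed
qed

lemma gromov_hausdorff_dist_le_correspondence:
  fixes X :: "'b mspace_pair" and Y :: "'c mspace_pair"
  assumes X: "Metric_space (fst X) (snd X)" and Y: "Metric_space (fst Y) (snd Y)"
    and R: "R \<subseteq> fst X \<times> fst Y" "R \<noteq> {}" and r: "r > 0"
    and left: "\<And>x. x \<in> fst X \<Longrightarrow> \<exists>y. (x, y) \<in> R"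
    and right: "\<And>y. y \<in> fst Y \<Longrightarrow> \<exists>x. (x, y) \<in> R"
    and dist: "\<And>a b a' b'. (a, b) \<in> R \<Longrightarrow> (a', b') \<in> R \<Longrightarrow> \<bar>snd X a a' - snd Y b b'\<bar> \<le> 2 * r"
  shows "gromov_hausdorff_dist X Y \<le> ennreal r"
proof -
  interpret X: Metric_space "fst X" "snd X" by fact
  interpret Y: Metric_space "fst Y" "snd Y" by fact
  define Z :: "('b + 'c) mspace_pair" where "Z = (fst X <+> fst Y, glued_dist X Y R r)"
  have close: "snd Z (Inl x) (Inr y) \<le> r" if xy: "(x, y) \<in> R" for x y
  proof -
    have mem: "x \<in> fst X" "y \<in> fst Y" using xy R(1) by auto
    have "bdd_below ((\<lambda>(a, b). snd X x a + r + snd Y b y) ` R)"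
      by (rule bdd_belowI[of _ 0]) (use r in \<open>auto intro!: add_nonneg_nonneg\<close>)
    from cINF_lower[OF this xy] mem show ?thesis
      by (simp add: Z_def glued_dist_def correspondence_dist_def)
  qed
  have "hausdorff_dist (snd Z) (Inl ` fst X) (Inr ` fst Y) \<le> ennreal r"
    unfolding hausdorff_dist_def
  proof (intro max.boundedI SUP_least)
    fix z :: "'b + 'c" assume "z \<in> Inl ` fst X"
    then obtain x y where "z = Inl x" "(x, y) \<in> R" using left by blast
    then show "(INF w\<in>Inr ` fst Y. ennreal (snd Z z w)) \<le> ennreal r"
      using close R(1) by (intro INF_lower2[of "Inr y"]) (auto intro: ennreal_leI)
  next
    fix w :: "'b + 'c" assume "w \<in> Inr ` fst Y"
    then obtain x y where "w = Inr y" "(x, y) \<in> R" using right by blast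
    then show "(INF z\<in>Inl ` fst X. ennreal (snd Z z w)) \<le> ennreal r"
      using close R(1) by (intro INF_lower2[of "Inl x"]) (auto intro: ennreal_leI)
  qed
  moreover have "Metric_space (fst Z) (snd Z)"
    unfolding Z_def fst_conv snd_conv using X Y R r dist by (rule Metric_space_glued)
  moreover have "isometric_embedding X Z Inl" "isometric_embedding Y Z Inr"
    by (auto simp: isometric_embedding_def Z_def glued_dist_def)
  ultimately show ?thesis
    unfolding gromov_hausdorff_dist_def by (intro Inf_lower2[OF _ \<open>hausdorff_dist _ _ _ \<le> _\<close>]) blast
qed

section \<open>Lineages in a recursive tree\<close>

text \<open>The vertices on the path from a vertex to the root. The root is left out so that the cardinality is the height.
  The minimum makes the recursion terminate for arbitrary \<open>p\<close> and has no effect when \<open>p m \<le> m\<close>.\<close>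

fun lineage :: "(nat \<Rightarrow> nat) \<Rightarrow> nat \<Rightarrow> nat set" where
  "lineage p 0 = {}"
| "lineage p (Suc 0) = {}"
| "lineage p (Suc (Suc n)) = insert (Suc (Suc n)) (lineage p (min (p (Suc n)) (Suc n)))"

lemma lineage_Suc:
  assumes "m \<ge> 1" "p m \<le> m"
  shows "lineage p (Suc m) = insert (Suc m) (lineage p (p m))"
  using assms by (cases m) auto

lemma lineage_subset: "lineage p v \<subseteq> {2..v}"
proof (induction p v rule: lineage.induct)
  case (3 p n)
  then show ?case by fastforce
qed auto

lemma finite_lineage [simp]: "finite (lineage p v)"
  using lineage_subset finite_subset by blast

lemma card_lineage_le: "card (lineage p v) \<le> v"
  using card_mono[OF _ lineage_subset[of p v]] by simp

lemma self_in_lineage: "v \<ge> 2 \<Longrightarrow> v \<in> lineage p v"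
  by (induction p v rule: lineage.induct) auto

lemma lineage_cong:
  assumes "\<And>i. i \<in> {1..<v} \<Longrightarrow> p i = q i"
  shows "lineage p v = lineage q v"
  using assms
proof (induction p v rule: lineage.induct)
  case (3 p n)
  have "p (Suc n) = q (Suc n)" using "3.prems" by simp
  with 3 show ?case by simp
qed auto

lemma recursive_tree_cong:
  assumes "\<And>i. i \<in> {1..<n} \<Longrightarrow> p i = q i"
  shows "recursive_tree p n = recursive_tree q n"
  using assms by (induction p n rule: recursive_tree.induct) auto

lemma vertices_recursive_tree: "fst (recursive_tree p n) = {1..n}"
  by (induction p n rule: recursive_tree.induct) (simp_all add: attach_leaf_def atLeastAtMostSuc_conv)

lemma edges_recursive_tree:
  "snd (recursive_tree p n) = (\<Union>m\<in>{1..<n}. {(Suc m, p m), (p m, Suc m)})"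
proof (induction p n rule: recursive_tree.induct)
  case (3 p n)
  have "{1..<Suc (Suc n)} = insert (Suc n) {1..<Suc n}" by auto
  with 3 show ?case by (auto simp: attach_leaf_def)
qed auto

lemma relpow_sym: "sym r \<Longrightarrow> (x, y) \<in> r ^^ l \<Longrightarrow> (y, x) \<in> r ^^ l"
proof (induction l arbitrary: y)
  case (Suc l)
  then obtain w where "(x, w) \<in> r ^^ l" "(w, y) \<in> r" by auto
  with Suc have "(y, w) \<in> r" "(w, x) \<in> r ^^ l" by (auto dest: symD)
  then show ?case by (rule relpow_Suc_I2)
qed auto

lemma Metric_space_graph_dist:
  assumes "connected_graph G" "sym (snd G)" "c > 0"
  shows "Metric_space (fst (scaled_graph_space c G)) (snd (scaled_graph_space c G))"
proof -
  let ?E = "snd G"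
  have walk: "(u, v) \<in> ?E ^^ graph_dist G u v" if "u \<in> fst G" "v \<in> fst G" for u v
    using assms(1) that LeastI_ex[of "\<lambda>l. (u, v) \<in> ?E ^^ l"]
    by (auto simp: graph_dist_def connected_graph_def dest: rtrancl_imp_relpow)
  have commute: "graph_dist G u v = graph_dist G v u" for u v
    unfolding graph_dist_def using relpow_sym[OF assms(2)] by metis
  have triangle: "graph_dist G u w \<le> graph_dist G u v + graph_dist G v w"
    if "u \<in> fst G" "v \<in> fst G" "w \<in> fst G" for u v w
  proof -
    have "(u, w) \<in> ?E ^^ (graph_dist G u v + graph_dist G v w)"
      using walk that by (auto simp: relpow_add)
    then show ?thesis unfolding graph_dist_def[of G u w] by (rule Least_le)
  qed
  have zero: "graph_dist G u v = 0 \<longleftrightarrow> u = v" if "u \<in> fst G" "v \<in> fst G" for u v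
    using walk[OF that] by (auto simp: graph_dist_def)
  show ?thesis
    unfolding scaled_graph_space_def
  proof (unfold_locales; simp)
    fix u v w
    show "0 \<le> c * real (graph_dist G u v)" using \<open>c > 0\<close> by simp
    show "c = 0 \<or> graph_dist G u v = graph_dist G v u" using commute by simp
    show "u \<in> fst G \<Longrightarrow> v \<in> fst G \<Longrightarrow> (c = 0 \<or> graph_dist G u v = 0) = (u = v)"
      using zero \<open>c > 0\<close> by simp
    show "c * real (graph_dist G u w) \<le> c * real (graph_dist G u v) + c * real (graph_dist G v w)"
      if "u \<in> fst G" "v \<in> fst G" "w \<in> fst G"
      using triangle[OF that] \<open>c > 0\<close> by (simp flip: distrib_left of_nat_add)
  qed
qed

text \<open>Every step of a walk changes the label set \<open>L\<close> in at most one element. With lineages as labels, this is how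
  lower bounds on distances are obtained.\<close>

lemma graph_dist_ge_card_sym_diff:
  assumes step: "\<And>u v. (u, v) \<in> snd G \<Longrightarrow> \<exists>x. (L u - L v) \<union> (L v - L u) \<subseteq> {x}"
    and walk: "(u, v) \<in> (snd G)\<^sup>*"
    and fin: "\<And>v. finite (L v)"
  shows "card (L u - L v \<union> (L v - L u)) \<le> graph_dist G u v"
proof -
  have "card (L u - L v \<union> (L v - L u)) \<le> l" if "(u, v) \<in> snd G ^^ l" for l
    using that
  proof (induction l arbitrary: v)
    case (Suc l)
    then obtain w where w: "(u, w) \<in> snd G ^^ l" "(w, v) \<in> snd G" by auto
    obtain x where "(L w - L v) \<union> (L v - L w) \<subseteq> {x}" using step[OF w(2)] by auto
    then have "L u - L v \<union> (L v - L u) \<subseteq> insert x (L u - L w \<union> (L w - L u))" by auto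
    then have "card (L u - L v \<union> (L v - L u)) \<le> card (insert x (L u - L w \<union> (L w - L u)))"
      using fin by (intro card_mono) auto
    also have "\<dots> \<le> Suc (card (L u - L w \<union> (L w - L u)))" by (rule card_insert_le_m1) auto
    finally show ?case using Suc.IH[OF w(1)] by simp
  qed auto
  moreover have "(u, v) \<in> snd G ^^ graph_dist G u v"
    using walk LeastI_ex[of "\<lambda>l. (u, v) \<in> snd G ^^ l"]
    by (auto simp: graph_dist_def dest: rtrancl_imp_relpow)
  ultimately show ?thesis by blast
qed

lemma lineage_edge:
  assumes p: "\<forall>m\<in>{1..<n}. p m \<in> {1..m}" and uv: "(u, v) \<in> snd (recursive_tree p n)"
  shows "lineage p u = insert u (lineage p v) \<or> lineage p v = insert v (lineage p u)"
proof -
  obtain m where "m \<in> {1..<n}" "(u, v) = (Suc m, p m) \<or> (u, v) = (p m, Suc m)"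
    using uv by (auto simp: edges_recursive_tree)
  with p lineage_Suc[of m p] show ?thesis by auto
qed

lemma lineage_trans:
  assumes p: "\<forall>m\<in>{1..<n}. p m \<in> {1..m}" and "v \<le> n" and x: "x \<in> lineage p v"
  shows "lineage p x \<subseteq> lineage p v"
  using \<open>v \<le> n\<close> x
proof (induction v rule: less_induct)
  case (less v)
  show ?case
  proof (cases "v \<ge> 2")
    case True
    then obtain m where m: "v = Suc m" "m \<ge> 1" by (cases v) auto
    have "p m \<in> {1..m}" using m less.prems p by auto
    with m less.prems less.IH[of "p m"] show ?thesis by (cases "x = v") (auto simp: lineage_Suc)
  qed (use less.prems lineage_subset[of p v] in auto)
qed

text \<open>Following the parents from \<open>v\<close> to \<open>x\<close> loses one element of the lineage per step. The walk stays in every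
  vertex set that contains the root and the lineage of \<open>v\<close>, hence it survives in the spanned subtree.\<close>

lemma lineage_walk:
  assumes p: "\<forall>m\<in>{1..<n}. p m \<in> {1..m}" and v: "v \<in> {1..n}"
    and x: "x \<in> insert 1 (lineage p v)" and W: "insert 1 (lineage p v) \<subseteq> W"
  shows "(v, x) \<in> (snd (induced_subgraph (recursive_tree p n) W))
           ^^ (card (lineage p v) - card (lineage p x))"
  using v x W
proof (induction v rule: less_induct)
  case (less v)
  show ?case
  proof (cases "x = v")
    case False
    have "v \<ge> 2" using less.prems(1,2) False lineage_subset[of p v] by (cases "v = 1") auto
    then obtain m where m: "v = Suc m" "m \<ge> 1" by (cases v) auto
    have pm: "p m \<in> {1..m}" using m less.prems p by auto
    have lin: "lineage p v = insert v (lineage p (p m))" using m pm by (simp add: lineage_Suc)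
    have notin: "v \<notin> lineage p (p m)" using lineage_subset[of p "p m"] m pm by auto
    have x: "x \<in> insert 1 (lineage p (p m))" using less.prems(2) lin False by auto
    have "card (lineage p x) \<le> card (lineage p (p m))"
      using x pm m less.prems(1) lineage_trans[OF p, of "p m" x] by (auto intro!: card_mono)
    then have "card (lineage p v) - card (lineage p x)
        = Suc (card (lineage p (p m)) - card (lineage p x))"
      using lin notin by simp
    moreover have "p m \<in> W"
      using less.prems(3) lin self_in_lineage[of "p m" p] pm by (cases "p m = 1") auto
    then have "(v, p m) \<in> snd (induced_subgraph (recursive_tree p n) W)"
      using m less.prems self_in_lineage[OF \<open>v \<ge> 2\<close>, of p]
      by (auto simp: induced_subgraph_def edges_recursive_tree)
    moreover have "(p m, x) \<in> (snd (induced_subgraph (recursive_tree p n) W))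
           ^^ (card (lineage p (p m)) - card (lineage p x))"
      using less.prems pm m x lin by (intro less.IH) auto
    ultimately show ?thesis by (simp only: relpow_Suc_I2)
  qed auto
qed

lemma sym_induced_recursive_tree: "sym (snd (induced_subgraph (recursive_tree p n) W))"
  by (auto simp: sym_def induced_subgraph_def edges_recursive_tree)

text \<open>The union of the lineages is connected through the root. It is the least such set: along an
  edge that avoids \<open>x\<close>, the property of being a descendant of \<open>x\<close> does not change, so a walk from a descendant of \<open>x\<close>
  to the root must visit \<open>x\<close>.\<close>

lemma spanned_subtree_recursive_tree:
  assumes p: "\<forall>m\<in>{1..<n}. p m \<in> {1..m}" and U: "U \<subseteq> {1..n}" "n \<ge> 1"
  shows "spanned_subtree (recursive_tree p n) (insert 1 U)
       = induced_subgraph (recursive_tree p n) (insert 1 (\<Union>u\<in>U. lineage p u))"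
    and "connected_graph (induced_subgraph (recursive_tree p n) (insert 1 (\<Union>u\<in>U. lineage p u)))"
proof -
  let ?T = "recursive_tree p n"
  define W where "W = insert 1 (\<Union>u\<in>U. lineage p u)"
  let ?E = "snd (induced_subgraph ?T W)"
  have sub: "insert 1 (lineage p v) \<subseteq> W" if "v \<in> W" for v
    using that U lineage_trans[OF p] by (fastforce simp: W_def)
  have W_sub: "W \<subseteq> {1..n}" using U lineage_subset by (fastforce simp: W_def)
  have root: "(v, 1) \<in> ?E\<^sup>*" if "v \<in> W" for v
    using lineage_walk[OF p, of v 1 W] sub[OF that] W_sub that
    by (meson insertI1 relpow_imp_rtrancl subsetD)
  have conn: "connected_graph (induced_subgraph ?T W)"
    unfolding connected_graph_def
  proof (intro conjI ballI)
    fix u v assume "u \<in> fst (induced_subgraph ?T W)" "v \<in> fst (induced_subgraph ?T W)"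
    then have "u \<in> W" "v \<in> W" by (auto simp: induced_subgraph_def)
    moreover have "sym (?E\<^sup>*)" using sym_induced_recursive_tree by (rule sym_rtrancl)
    ultimately show "(u, v) \<in> ?E\<^sup>*" using root by (meson rtrancl_trans symD)
  qed (simp add: induced_subgraph_def W_def)
  have least: "W \<subseteq> S"
    if S: "insert 1 U \<subseteq> S" "S \<subseteq> fst ?T" "connected_graph (induced_subgraph ?T S)" for S
  proof
    fix x assume "x \<in> W"
    show "x \<in> S"
    proof (cases "x = 1")
      case False
      then obtain u where u: "u \<in> U" "x \<in> lineage p u" using \<open>x \<in> W\<close> by (auto simp: W_def)
      have path: "(u, 1) \<in> (snd (induced_subgraph ?T S))\<^sup>*"
        using S u by (auto simp: connected_graph_def induced_subgraph_def)
      show ?thesis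
      proof (rule ccontr)
        assume "x \<notin> S"
        from path have "x \<in> lineage p 1"
        proof (induction rule: rtrancl_induct)
          case (step y z)
          then have "(y, z) \<in> snd ?T" "y \<in> S" by (auto simp: induced_subgraph_def)
          with lineage_edge[OF p, of y z] step.IH \<open>x \<notin> S\<close> show ?case by auto
        qed (rule u(2))
        then show False by simp
      qed
    qed (use S in auto)
  qed
  have "U \<subseteq> W"
  proof
    fix u assume "u \<in> U"
    then have "u = 1 \<or> u \<in> lineage p u" using U self_in_lineage[of u p] by fastforce
    with \<open>u \<in> U\<close> show "u \<in> W" by (auto simp: W_def)
  qed
  then have "(\<Inter>{S. insert 1 U \<subseteq> S \<and> S \<subseteq> fst ?T \<and> connected_graph (induced_subgraph ?T S)}) = W"
    using least conn W_sub by (intro equalityI Inter_lower Inter_greatest)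
      (auto simp: vertices_recursive_tree W_def)
  then show "spanned_subtree ?T (insert 1 U) = induced_subgraph ?T (insert 1 (\<Union>u\<in>U. lineage p u))"
    by (simp add: spanned_subtree_def W_def)
  show "connected_graph (induced_subgraph ?T (insert 1 (\<Union>u\<in>U. lineage p u)))"
    using conn by (simp add: W_def)
qed

section \<open>Comparing a spanned subtree with a star\<close>

lemma lineage_total:
  assumes p: "\<forall>m\<in>{1..<n}. p m \<in> {1..m}" and "v \<in> {1..n}"
    and "x \<in> insert 1 (lineage p v)" "y \<in> insert 1 (lineage p v)" "x \<le> y"
  shows "x \<in> insert 1 (lineage p y)"
  using assms(2-)
proof (induction v rule: less_induct)
  case (less v)
  show ?case
  proof (cases "v = y \<or> x = 1")
    case False
    have "v \<ge> 2" using less.prems(1,2) False lineage_subset[of p v] by (cases "v = 1") auto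
    then obtain m where m: "v = Suc m" "m \<ge> 1" by (cases v) auto
    have pm: "p m \<in> {1..m}" using m less.prems p by auto
    have lin: "lineage p v = insert v (lineage p (p m))" using m pm by (simp add: lineage_Suc)
    have "y \<le> v" using less.prems lineage_subset[of p v] by auto
    with False less.prems(4) have "x \<noteq> v" "y \<noteq> v" by auto
    then show ?thesis
      using less.prems lin pm m by (intro less.IH[of "p m"]) auto
  qed (use less.prems in auto)
qed

text \<open>Needed to hit every point of a leg of the star up to a small error.\<close>

lemma lineage_all_heights:
  assumes p: "\<forall>m\<in>{1..<n}. p m \<in> {1..m}" and "v \<in> {1..n}"
    and "l \<le> card (lineage p v)"
  shows "\<exists>x\<in>insert 1 (lineage p v). card (lineage p x) = l"
  using assms(2-)
proof (induction v rule: less_induct)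
  case (less v)
  show ?case
  proof (cases "v = 1 \<or> l = card (lineage p v)")
    case True
    then show ?thesis using less.prems self_in_lineage[of v p] by (cases "v = 1") auto
  next
    case False
    then obtain m where m: "v = Suc m" "m \<ge> 1" using less.prems by (cases v) auto
    have pm: "p m \<in> {1..m}" using m less.prems p by auto
    have lin: "lineage p v = insert v (lineage p (p m))" using m pm by (simp add: lineage_Suc)
    have notin: "v \<notin> lineage p (p m)" using lineage_subset[of p "p m"] m pm by auto
    have "\<exists>x\<in>insert 1 (lineage p (p m)). card (lineage p x) = l"
      using less.prems lin notin False pm m by (intro less.IH) auto
    then show ?thesis using lin by auto
  qed
qed

context
  fixes p :: "nat \<Rightarrow> nat" and n :: nat and U :: "nat set"
  assumes p: "\<forall>m\<in>{1..<n}. p m \<in> {1..m}" and U: "U \<subseteq> {1..n}" "n \<ge> 1"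
begin

abbreviation (input) "T\<^sub>U \<equiv> spanned_subtree (recursive_tree p n) (insert 1 U)"

lemma vertices_spanned: "fst T\<^sub>U = insert 1 (\<Union>u\<in>U. lineage p u)"
  using spanned_subtree_recursive_tree(1)[OF p U] by (simp add: induced_subgraph_def)

lemma vertices_spanned_subset: "fst T\<^sub>U \<subseteq> {1..n}"
  using U lineage_subset unfolding vertices_spanned by fastforce

lemma lineage_subset_spanned: "x \<in> fst T\<^sub>U \<Longrightarrow> insert 1 (lineage p x) \<subseteq> fst T\<^sub>U"
  using U lineage_trans[OF p] unfolding vertices_spanned by fastforce

lemma sym_spanned: "sym (snd T\<^sub>U)"
  using spanned_subtree_recursive_tree(1)[OF p U] sym_induced_recursive_tree by simp

lemma connected_spanned: "connected_graph T\<^sub>U"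
  using spanned_subtree_recursive_tree[OF p U] by simp

lemma spanned_walk:
  assumes "v \<in> fst T\<^sub>U" "x \<in> insert 1 (lineage p v)"
  shows "(v, x) \<in> snd T\<^sub>U ^^ (card (lineage p v) - card (lineage p x))"
proof -
  have "v \<in> {1..n}" using assms(1) vertices_spanned_subset by auto
  from lineage_walk[OF p this assms(2) lineage_subset_spanned[OF assms(1)]] show ?thesis
    using spanned_subtree_recursive_tree(1)[OF p U] by (simp add: vertices_spanned[symmetric] induced_subgraph_def)
qed

lemma graph_dist_spanned_ge:
  assumes "x \<in> fst T\<^sub>U" "y \<in> fst T\<^sub>U"
  shows "card (lineage p x - lineage p y \<union> (lineage p y - lineage p x)) \<le> graph_dist T\<^sub>U x y"
proof (rule graph_dist_ge_card_sym_diff)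
  fix u v assume "(u, v) \<in> snd T\<^sub>U"
  then have "(u, v) \<in> snd (recursive_tree p n)"
    using spanned_subtree_recursive_tree(1)[OF p U] by (simp add: induced_subgraph_def)
  then show "\<exists>x. lineage p u - lineage p v \<union> (lineage p v - lineage p u) \<subseteq> {x}"
    using lineage_edge[OF p, of u v] by blast
qed (use assms connected_spanned in \<open>auto simp: connected_graph_def\<close>)

text \<open>Vertices whose lineages share little are almost as far apart as a detour through the root suggests.\<close>

lemma graph_dist_spanned_ge_diff:
  assumes "x \<in> fst T\<^sub>U" "y \<in> fst T\<^sub>U"
  shows "card (lineage p x) + card (lineage p y)
       \<le> graph_dist T\<^sub>U x y + 2 * card (lineage p x \<inter> lineage p y)"
proof -
  let ?X = "lineage p x" and ?Y = "lineage p y"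
  have "card (?X - ?Y \<union> (?Y - ?X)) = card (?X - ?Y) + card (?Y - ?X)"
    by (intro card_Un_disjoint) auto
  moreover have "card ?X = card (?X - ?Y) + card (?X \<inter> ?Y)"
    by (subst card_Un_disjoint[symmetric]) (auto intro!: arg_cong[where f = card])
  moreover have "card ?Y = card (?Y - ?X) + card (?X \<inter> ?Y)"
    by (subst card_Un_disjoint[symmetric]) (auto intro!: arg_cong[where f = card])
  ultimately show ?thesis using graph_dist_spanned_ge[OF assms] by linarith
qed

lemma graph_dist_spanned_le_sum:
  assumes "x \<in> fst T\<^sub>U" "y \<in> fst T\<^sub>U"
  shows "graph_dist T\<^sub>U x y \<le> card (lineage p x) + card (lineage p y)"
proof -
  have "(x, 1) \<in> snd T\<^sub>U ^^ card (lineage p x)" using spanned_walk[OF assms(1), of 1] by simp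
  moreover have "(1, y) \<in> snd T\<^sub>U ^^ card (lineage p y)"
    using spanned_walk[OF assms(2), of 1] sym_spanned by (auto intro: relpow_sym)
  ultimately have "(x, y) \<in> snd T\<^sub>U ^^ (card (lineage p x) + card (lineage p y))"
    by (auto simp: relpow_add)
  then show ?thesis unfolding graph_dist_def by (rule Least_le)
qed

lemma graph_dist_spanned_same_lineage:
  assumes u: "u \<in> U" and x: "x \<in> insert 1 (lineage p u)" and y: "y \<in> insert 1 (lineage p u)"
  shows "real (graph_dist T\<^sub>U x y) = \<bar>real (card (lineage p x)) - real (card (lineage p y))\<bar>"
proof -
  have mem: "x \<in> fst T\<^sub>U" "y \<in> fst T\<^sub>U" using assms unfolding vertices_spanned by auto
  have un: "u \<in> {1..n}" using u U by auto
  have *: "graph_dist T\<^sub>U b a \<le> card (lineage p b) - card (lineage p a) \<and>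
      graph_dist T\<^sub>U a b \<le> card (lineage p b) - card (lineage p a) \<and>
      card (lineage p a) \<le> card (lineage p b)"
    if ab: "a \<le> b" "a \<in> insert 1 (lineage p u)" "b \<in> insert 1 (lineage p u)" for a b
  proof -
    have b: "b \<in> fst T\<^sub>U" using ab u unfolding vertices_spanned by auto
    have a: "a \<in> insert 1 (lineage p b)" using lineage_total[OF p un] ab by blast
    have "(b, a) \<in> snd T\<^sub>U ^^ (card (lineage p b) - card (lineage p a))"
      using spanned_walk[OF b a] .
    moreover have "(a, b) \<in> snd T\<^sub>U ^^ (card (lineage p b) - card (lineage p a))"
      using calculation sym_spanned by (auto intro: relpow_sym)
    moreover have "card (lineage p a) \<le> card (lineage p b)"
      using a b subsetD[OF vertices_spanned_subset b] lineage_trans[OF p, of b a]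
      by (auto intro!: card_mono)
    ultimately show ?thesis unfolding graph_dist_def by (auto intro: Least_le)
  qed
  let ?X = "lineage p x" and ?Y = "lineage p y"
  have "card ?X - card ?Y \<le> card (?X - ?Y)" "card ?Y - card ?X \<le> card (?Y - ?X)"
    by (simp_all add: diff_card_le_card_Diff)
  moreover have "card (?X - ?Y) \<le> card (?X - ?Y \<union> (?Y - ?X))"
    "card (?Y - ?X) \<le> card (?X - ?Y \<union> (?Y - ?X))"
    by (auto intro!: card_mono)
  ultimately have "card ?X - card ?Y \<le> graph_dist T\<^sub>U x y" "card ?Y - card ?X \<le> graph_dist T\<^sub>U x y"
    using graph_dist_spanned_ge[OF mem] by linarith+
  then show ?thesis using *[of x y] *[of y x] x y by (cases "x \<le> y") (auto simp: abs_if)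
qed

end

text \<open>Polar coordinates on the star: all legs start in the common centre \<open>(0, 0)\<close>.\<close>

definition star_point :: "nat \<Rightarrow> real \<Rightarrow> nat \<times> real" where
  "star_point i t = (if t = 0 then (0, 0) else (i, t))"

lemma star_dist_star_point:
  assumes "0 \<le> s" "0 \<le> t"
  shows "snd (star_space k) (star_point i s) (star_point j t) = (if i = j then \<bar>s - t\<bar> else s + t)"
  using assms by (auto simp: star_space_def star_point_def)

text \<open>A vertex \<open>x\<close> corresponds to the point at distance about \<open>c\<close> times the height of \<open>x\<close> on the leg of \<open>u i\<close>
  whenever \<open>x\<close> is an ancestor of \<open>u i\<close>. Two ancestors of the same \<open>u i\<close> have the right distance, up to \<open>2 * \<eta>\<close>, because
  they lie on one path to the root. For ancestors of \<open>u i\<close> and \<open>u j\<close> the path through the root is too long by at most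
  twice the number of common ancestors, which adds \<open>2 * \<eta>\<close>. A common ancestor of \<open>u i\<close> and \<open>u j\<close> corresponds to points on
  both legs; this is harmless because it is close to the root. The total distortion is \<open>4 * \<eta>\<close>.\<close>

lemma spanned_subtree_close_to_star:
  fixes u :: "nat \<Rightarrow> nat" and c \<eta> :: real
  assumes p: "\<forall>m\<in>{1..<n}. p m \<in> {1..m}"
    and "k \<ge> 1" and u: "\<And>i. i \<in> {1..k} \<Longrightarrow> u i \<in> {1..n}"
    and c: "0 < c" "c \<le> \<eta>"
    and height: "\<And>i. i \<in> {1..k} \<Longrightarrow> \<bar>c * real (card (lineage p (u i))) - 1\<bar> \<le> \<eta>"
    and common: "\<And>i j. i \<in> {1..k} \<Longrightarrow> j \<in> {1..k} \<Longrightarrow> i \<noteq> j \<Longrightarrow>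
      c * real (card (lineage p (u i) \<inter> lineage p (u j))) \<le> \<eta>"
  shows "gromov_hausdorff_dist
      (scaled_graph_space c (spanned_subtree (recursive_tree p n) (insert 1 (u ` {1..k}))))
      (star_space k) \<le> ennreal (2 * \<eta>)"
proof -
  let ?U = "u ` {1..k}"
  let ?T = "spanned_subtree (recursive_tree p n) (insert 1 ?U)"
  let ?h = "\<lambda>x. real (card (lineage p x))"
  have U: "?U \<subseteq> {1..n}" using u by auto
  have "n \<ge> 1" using u[of 1] \<open>k \<ge> 1\<close> by auto
  note facts = p U \<open>n \<ge> 1\<close>
  have V: "fst ?T = insert 1 (\<Union>u\<in>?U. lineage p u)" by (rule vertices_spanned[OF facts])
  define R where "R = {(x, star_point i t) | x i t. i \<in> {1..k} \<and> x \<in> insert 1 (lineage p (u i)) \<and>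
    0 \<le> t \<and> t \<le> 1 \<and> \<bar>c * ?h x - t\<bar> \<le> \<eta>}"
  have star: "star_point i t \<in> fst (star_space k)" if "i \<in> {1..k}" "0 \<le> t" "t \<le> 1" for i t
    using that by (auto simp: star_space_def star_point_def)
  have mono: "?h x \<le> ?h (u i)" if "i \<in> {1..k}" "x \<in> insert 1 (lineage p (u i))" for i x
    using that lineage_trans[OF p, of "u i" x] u[of i] by (auto intro!: card_mono)
  show ?thesis
  proof (rule gromov_hausdorff_dist_le_correspondence[where R = R])
    show "Metric_space (fst (scaled_graph_space c ?T)) (snd (scaled_graph_space c ?T))"
      using connected_spanned[OF facts] sym_spanned[OF facts] c(1) by (rule Metric_space_graph_dist)
    show "Metric_space (fst (star_space k)) (snd (star_space k))" by (rule Metric_space_star)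
    show "2 * \<eta> > 0" using c by simp
    show "R \<subseteq> fst (scaled_graph_space c ?T) \<times> fst (star_space k)"
      using star unfolding R_def scaled_graph_space_def fst_conv V by blast
    have "(1, star_point 1 0) \<in> R" using \<open>k \<ge> 1\<close> c by (force simp: R_def)
    then show "R \<noteq> {}" by blast
  next
    fix x assume "x \<in> fst (scaled_graph_space c ?T)"
    then have "x \<in> insert 1 (\<Union>u\<in>?U. lineage p u)" unfolding scaled_graph_space_def fst_conv V .
    moreover have "1 \<in> {1..k}" using \<open>k \<ge> 1\<close> by simp
    ultimately obtain i where i: "i \<in> {1..k}" "x \<in> insert 1 (lineage p (u i))"
      by blast
    have "c * ?h x \<le> c * ?h (u i)" using mono[OF i] c by simp
    then have "\<bar>c * ?h x - min 1 (c * ?h x)\<bar> \<le> \<eta>"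
      using c(1) c(2) height[OF i(1)] by linarith
    moreover have "0 \<le> min 1 (c * ?h x)" "min 1 (c * ?h x) \<le> 1" using c by auto
    ultimately have "(x, star_point i (min 1 (c * ?h x))) \<in> R"
      using i unfolding R_def by blast
    then show "\<exists>y. (x, y) \<in> R" ..
  next
    fix y assume y: "y \<in> fst (star_space k)"
    then obtain i t where i: "i \<in> {1..k}" and t: "y = star_point i t" "0 \<le> t" "t \<le> 1"
    proof (cases "y = (0, 0)")
      case True
      then show ?thesis using that[of 1 0] \<open>k \<ge> 1\<close> by (simp add: star_point_def)
    next
      case False
      then show ?thesis using y that[of "fst y" "snd y"] by (auto simp: star_space_def star_point_def)
    qed
    \<comment> \<open>The lineage of \<open>u i\<close> may end before height \<open>t / c\<close>; then \<open>t\<close> is within \<open>\<eta>\<close> of its rescaled length.\<close>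
    define l where "l = min (nat \<lfloor>t / c\<rfloor>) (card (lineage p (u i)))"
    have "\<exists>x\<in>insert 1 (lineage p (u i)). card (lineage p x) = l"
      by (rule lineage_all_heights[OF p u[OF i]]) (simp add: l_def)
    then obtain x where x: "x \<in> insert 1 (lineage p (u i))" "card (lineage p x) = l"
      by blast
    have fl: "real (nat \<lfloor>t / c\<rfloor>) \<le> t / c" "t / c < real (nat \<lfloor>t / c\<rfloor>) + 1"
      using t c by (auto simp: real_nat_ceiling_ge)
    then have fl: "c * real (nat \<lfloor>t / c\<rfloor>) \<le> t" "t < c * real (nat \<lfloor>t / c\<rfloor>) + c"
      using c by (auto simp: field_simps)
    have "\<bar>c * real l - t\<bar> \<le> \<eta>"
    proof (cases "nat \<lfloor>t / c\<rfloor> \<le> card (lineage p (u i))")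
      case True
      then show ?thesis using fl c by (simp add: l_def)
    next
      case False
      then have "c * ?h (u i) \<le> c * real (nat \<lfloor>t / c\<rfloor>)"
        using c by (intro mult_left_mono) auto
      moreover have "c * real l = c * ?h (u i)" using False by (simp add: l_def)
      ultimately show ?thesis using fl(1) t(3) height[OF i] by linarith
    qed
    then have "(x, y) \<in> R" using i x t unfolding R_def by blast
    then show "\<exists>x. (x, y) \<in> R" ..
  next
    fix a b a' b' assume "(a, b) \<in> R" "(a', b') \<in> R"
    then obtain i t i' t' where
      1: "b = star_point i t" "i \<in> {1..k}" "a \<in> insert 1 (lineage p (u i))" "0 \<le> t"
        "\<bar>c * ?h a - t\<bar> \<le> \<eta>" and
      2: "b' = star_point i' t'" "i' \<in> {1..k}" "a' \<in> insert 1 (lineage p (u i'))" "0 \<le> t'"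
        "\<bar>c * ?h a' - t'\<bar> \<le> \<eta>"
      unfolding R_def by blast
    have mem: "a \<in> fst ?T" "a' \<in> fst ?T" using 1 2 unfolding V by auto
    let ?d = "real (graph_dist ?T a a')"
    have d: "snd (scaled_graph_space c ?T) a a' = c * ?d" by (simp add: scaled_graph_space_def)
    show "\<bar>snd (scaled_graph_space c ?T) a a' - snd (star_space k) b b'\<bar> \<le> 2 * (2 * \<eta>)"
    proof (cases "i = i'")
      case True
      have "c * ?d = \<bar>c * ?h a - c * ?h a'\<bar>"
        using graph_dist_spanned_same_lineage[OF facts, of "u i" a a'] 1 2 True c
        by (simp add: abs_mult flip: right_diff_distrib)
      moreover have "snd (star_space k) b b' = \<bar>t - t'\<bar>"
        using 1 2 True by (simp add: star_dist_star_point)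
      ultimately show ?thesis using 1 2 c unfolding d by linarith
    next
      case False
      have "card (lineage p a \<inter> lineage p a') \<le> card (lineage p (u i) \<inter> lineage p (u i'))"
        using lineage_trans[OF p, of "u i" a] lineage_trans[OF p, of "u i'" a'] 1 2 u[of i] u[of i']
        by (intro card_mono) auto
      moreover have "?h a + ?h a' \<le> ?d + 2 * real (card (lineage p a \<inter> lineage p a'))"
        using graph_dist_spanned_ge_diff[OF facts mem] by linarith
      ultimately have "?h a + ?h a' \<le> ?d + 2 * real (card (lineage p (u i) \<inter> lineage p (u i')))"
        by linarith
      then have "c * (?h a + ?h a') \<le> c * (?d + 2 * real (card (lineage p (u i) \<inter> lineage p (u i'))))"
        using c by simp
      then have lo: "c * ?h a + c * ?h a' \<le> c * ?d + 2 * \<eta>"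
        using common[OF 1(2) 2(2) False] by (simp add: algebra_simps)
      have "?d \<le> ?h a + ?h a'"
        using graph_dist_spanned_le_sum[OF facts mem] by linarith
      then have "c * ?d \<le> c * (?h a + ?h a')" using c by simp
      then have up: "c * ?d \<le> c * ?h a + c * ?h a'" by (simp add: algebra_simps)
      have "snd (star_space k) b b' = t + t'"
        using 1 2 False by (simp add: star_dist_star_point)
      then show ?thesis using 1 2 c lo up unfolding d by linarith
    qed
  qed
qed

section \<open>The typical height and the choice window\<close>

text \<open>The integral of \<open>2 * x powr (- \<beta>)\<close> from 0 to \<open>n\<close>: near \<open>x\<close>, a step towards the root has mean length about \<open>x powr \<beta> / 2\<close>.\<close>

definition typical_height :: "real \<Rightarrow> nat \<Rightarrow> real" where
  "typical_height \<beta> n = 2 / (1 - \<beta>) * real n powr (1 - \<beta>)"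

definition window :: "real \<Rightarrow> nat \<Rightarrow> nat set" where
  "window \<beta> m = {v \<in> {1..m}. mesoscopic \<beta> m \<le> v \<and> v \<le> m}"

lemma finite_window [simp]: "finite (window \<beta> m)"
  by (simp add: window_def)

lemma window_nonempty: "m \<ge> 1 \<Longrightarrow> window \<beta> m \<noteq> {}"
  by (auto simp: window_def mesoscopic_def intro!: exI[of _ m])

lemma card_window_pos: "m \<ge> 1 \<Longrightarrow> card (window \<beta> m) > 0"
  using window_nonempty by (simp add: card_gt_0_iff)

lemma window_subset: "window \<beta> m \<subseteq> {1..m}"
  by (auto simp: window_def)

text \<open>The mean value theorem, as the derivative \<open>2 * x powr (- \<beta>)\<close> of the typical height decreases.\<close>

lemma typical_height_diff:
  assumes \<beta>: "0 < \<beta>" "\<beta> < 1" and ab: "0 < a" "a < b"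
  shows "2 * real b powr (- \<beta>) * real (b - a) \<le> typical_height \<beta> b - typical_height \<beta> a"
    and "typical_height \<beta> b - typical_height \<beta> a \<le> 2 * real a powr (- \<beta>) * real (b - a)"
proof -
  have "\<exists>z>real a. z < real b \<and> 2 / (1 - \<beta>) * real b powr (1 - \<beta>) - 2 / (1 - \<beta>) * real a powr (1 - \<beta>)
      = (real b - real a) * (2 * z powr (- \<beta>))"
  proof (rule MVT2)
    fix x assume "real a \<le> x"
    then have "((\<lambda>x. 2 / (1 - \<beta>) * x powr (1 - \<beta>)) has_real_derivative
        2 / (1 - \<beta>) * ((1 - \<beta>) * x powr (1 - \<beta> - 1))) (at x)"
      using ab by (intro DERIV_cmult has_real_derivative_powr) auto
    then show "((\<lambda>x. 2 / (1 - \<beta>) * x powr (1 - \<beta>)) has_real_derivative 2 * x powr (- \<beta>)) (at x)"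
      using \<beta> by simp
  qed (use ab in simp)
  then obtain z where z: "real a < z" "z < real b"
    "typical_height \<beta> b - typical_height \<beta> a = real (b - a) * (2 * z powr (- \<beta>))"
    using ab by (auto simp: typical_height_def of_nat_diff)
  have "real b powr (- \<beta>) \<le> z powr (- \<beta>)" "z powr (- \<beta>) \<le> real a powr (- \<beta>)"
    using z(1,2) ab \<beta> by (auto intro!: powr_mono2')
  then show "2 * real b powr (- \<beta>) * real (b - a) \<le> typical_height \<beta> b - typical_height \<beta> a"
    "typical_height \<beta> b - typical_height \<beta> a \<le> 2 * real a powr (- \<beta>) * real (b - a)"
    unfolding z(3) by (simp_all add: mult.commute mult_left_mono)
qed

text \<open>For \<open>m = 1\<close> the window is \<open>{1}\<close> rather than \<open>{0..1}\<close>, which is why \<open>m\<close> must be at least 2.\<close>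

lemma window_eq:
  assumes \<beta>: "0 < \<beta>" "\<beta> < 1" and m: "m \<ge> 2"
  obtains L where "L < m" "window \<beta> m = {m - L..m}" "card (window \<beta> m) = L + 1"
    "real L \<le> real m powr \<beta>" "real m powr \<beta> < real L + 1"
proof -
  define L where "L = nat \<lfloor>real m powr \<beta>\<rfloor>"
  have "real m powr \<beta> < real m powr 1" using \<beta> m by (intro powr_less_mono) auto
  then have "real m powr \<beta> < real m" using m by simp
  moreover have L: "real L \<le> real m powr \<beta>" "real m powr \<beta> < real L + 1"
    by (auto simp: L_def)
  ultimately have "L < m" by linarith
  then have w: "window \<beta> m = {m - L..m}" by (auto simp: window_def mesoscopic_def L_def)
  with \<open>L < m\<close> have "card (window \<beta> m) = L + 1" by simp
  with that L w \<open>L < m\<close> show thesis by blast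
qed

lemma sum_window_gap:
  assumes "L < m"
  shows "(\<Sum>v\<in>{m - L..m}. real (Suc m - v)) = real (L + 1) * (real L + 2) / 2"
proof -
  have "(\<Sum>v\<in>{m - L..m}. real (Suc m - v)) = (\<Sum>i\<in>{..L}. real (i + 1))"
    by (rule sum.reindex_bij_witness[where i = "\<lambda>i. m - i" and j = "\<lambda>v. m - v"])
      (use assms in auto)
  also have "\<dots> = real (L + 1) * (real L + 2) / 2"
    by (induction L) (auto simp: field_simps)
  finally show ?thesis .
qed

definition mean_gain :: "real \<Rightarrow> nat \<Rightarrow> real" where
  "mean_gain \<beta> m = (\<Sum>v\<in>window \<beta> m. typical_height \<beta> (Suc m) - typical_height \<beta> v)
     / real (card (window \<beta> m))"

lemma eventually_gap_bounds:
  assumes \<beta>: "0 < \<beta>" "\<beta> < 1"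
  shows "\<forall>\<^sub>F m in sequentially. \<forall>v\<in>window \<beta> m.
    0 \<le> typical_height \<beta> (Suc m) - typical_height \<beta> v \<and>
    typical_height \<beta> (Suc m) - typical_height \<beta> v \<le> 3"
proof -
  have "(\<lambda>m. 2 * (real m - real m powr \<beta>) powr (- \<beta>) * (real m powr \<beta> + 1)) \<longlonglongrightarrow> 2"
    using \<beta> by real_asymp
  then have "\<forall>\<^sub>F m in sequentially. 2 * (real m - real m powr \<beta>) powr (- \<beta>) * (real m powr \<beta> + 1) < 3"
    by (rule order_tendstoD) simp
  then show ?thesis
    using eventually_ge_at_top[of "2::nat"]
  proof eventually_elim
    case (elim m)
    obtain L where L: "L < m" "window \<beta> m = {m - L..m}" "card (window \<beta> m) = L + 1"
      "real L \<le> real m powr \<beta>" "real m powr \<beta> < real L + 1"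
      using window_eq[OF \<beta> elim(2)] .
    have "real m powr \<beta> < real m powr 1" using \<beta> elim by (intro powr_less_mono) auto
    then have pos: "real m - real m powr \<beta> > 0" using elim by simp
    show ?case
    proof
      fix v assume "v \<in> window \<beta> m"
      then have v: "0 < v" "v < Suc m" "real m - real m powr \<beta> \<le> real v" "real (Suc m - v) \<le> real m powr \<beta> + 1"
        using L by auto
      have "real v powr (- \<beta>) \<le> (real m - real m powr \<beta>) powr (- \<beta>)"
        using pos v \<beta> by (intro powr_mono2') auto
      then have "2 * real v powr (- \<beta>) * real (Suc m - v)
          \<le> 2 * (real m - real m powr \<beta>) powr (- \<beta>) * (real m powr \<beta> + 1)"
        using v by (intro mult_mono) auto
      with elim(1) typical_height_diff(2)[OF \<beta> v(1,2)]
      have "typical_height \<beta> (Suc m) - typical_height \<beta> v \<le> 3" by linarith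
      moreover have "0 \<le> 2 * real (Suc m) powr (- \<beta>) * real (Suc m - v)" by simp
      with typical_height_diff(1)[OF \<beta> v(1,2)]
      have "0 \<le> typical_height \<beta> (Suc m) - typical_height \<beta> v" by linarith
      ultimately show "0 \<le> typical_height \<beta> (Suc m) - typical_height \<beta> v \<and>
        typical_height \<beta> (Suc m) - typical_height \<beta> v \<le> 3" by simp
    qed
  qed
qed

text \<open>The mean distance from \<open>m + 1\<close> to its parent is \<open>(L + 2) / 2\<close> when the window has \<open>L + 1\<close> elements, and the slope of the
  typical height on the window is close to \<open>2 * m powr (- \<beta>)\<close>. The product tends to 1 since the window is short
  compared with \<open>m\<close>.\<close>

lemma mean_gain_tendsto:
  assumes \<beta>: "0 < \<beta>" "\<beta> < 1"
  shows "mean_gain \<beta> \<longlonglongrightarrow> 1"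
proof (rule tendsto_sandwich)
  show "(\<lambda>m. (real m + 1) powr (- \<beta>) * (real m powr \<beta> + 1)) \<longlonglongrightarrow> 1"
    using \<beta> by real_asymp
  show "(\<lambda>m. (real m - real m powr \<beta>) powr (- \<beta>) * (real m powr \<beta> + 2)) \<longlonglongrightarrow> 1"
    using \<beta> by real_asymp
  have both: "(real m + 1) powr (- \<beta>) * (real m powr \<beta> + 1) \<le> mean_gain \<beta> m \<and>
    mean_gain \<beta> m \<le> (real m - real m powr \<beta>) powr (- \<beta>) * (real m powr \<beta> + 2)"
    if m: "m \<ge> 2" for m
  proof -
    obtain L where L: "L < m" "window \<beta> m = {m - L..m}" "card (window \<beta> m) = L + 1"
      "real L \<le> real m powr \<beta>" "real m powr \<beta> < real L + 1"
      using window_eq[OF \<beta> m] .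
    have "real m powr \<beta> < real m powr 1" using \<beta> m by (intro powr_less_mono) auto
    then have pos: "real m - real m powr \<beta> > 0" using m by simp
    let ?gap = "\<Sum>v\<in>window \<beta> m. real (Suc m - v)"
    have gap: "?gap / real (card (window \<beta> m)) = (real L + 2) / 2"
      using sum_window_gap[OF L(1)] L by simp
    have "(\<Sum>v\<in>window \<beta> m. 2 * (real m + 1) powr (- \<beta>) * real (Suc m - v))
        \<le> (\<Sum>v\<in>window \<beta> m. typical_height \<beta> (Suc m) - typical_height \<beta> v)"
      using typical_height_diff(1)[OF \<beta>, of _ "Suc m"] L
      by (intro sum_mono) (auto simp: add.commute)
    then have "2 * (real m + 1) powr (- \<beta>) * ?gap / real (card (window \<beta> m)) \<le> mean_gain \<beta> m"
      by (simp add: mean_gain_def sum_distrib_left divide_right_mono)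
    then have "2 * (real m + 1) powr (- \<beta>) * (?gap / real (card (window \<beta> m))) \<le> mean_gain \<beta> m"
      by simp
    then have lo: "(real m + 1) powr (- \<beta>) * (real L + 2) \<le> mean_gain \<beta> m"
      unfolding gap by simp
    have "(\<Sum>v\<in>window \<beta> m. typical_height \<beta> (Suc m) - typical_height \<beta> v)
        \<le> (\<Sum>v\<in>window \<beta> m. 2 * (real m - real m powr \<beta>) powr (- \<beta>) * real (Suc m - v))"
    proof (rule sum_mono)
      fix v assume "v \<in> window \<beta> m"
      then have v: "0 < v" "v < Suc m" "real m - real m powr \<beta> \<le> real v" using L by auto
      have "real v powr (- \<beta>) \<le> (real m - real m powr \<beta>) powr (- \<beta>)"
        using pos v \<beta> by (intro powr_mono2') auto
      then have "2 * real v powr (- \<beta>) * real (Suc m - v)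
          \<le> 2 * (real m - real m powr \<beta>) powr (- \<beta>) * real (Suc m - v)"
        by (intro mult_mono) auto
      with typical_height_diff(2)[OF \<beta> v(1,2)]
      show "typical_height \<beta> (Suc m) - typical_height \<beta> v
          \<le> 2 * (real m - real m powr \<beta>) powr (- \<beta>) * real (Suc m - v)" by linarith
    qed
    then have "mean_gain \<beta> m \<le> 2 * (real m - real m powr \<beta>) powr (- \<beta>) * ?gap / real (card (window \<beta> m))"
      by (simp add: mean_gain_def sum_distrib_left divide_right_mono)
    then have "mean_gain \<beta> m
        \<le> 2 * (real m - real m powr \<beta>) powr (- \<beta>) * (?gap / real (card (window \<beta> m)))"
      by simp
    then have up: "mean_gain \<beta> m \<le> (real m - real m powr \<beta>) powr (- \<beta>) * (real L + 2)"
      unfolding gap by simp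
    have "(real m + 1) powr (- \<beta>) * (real m powr \<beta> + 1) \<le> (real m + 1) powr (- \<beta>) * (real L + 2)"
      "(real m - real m powr \<beta>) powr (- \<beta>) * (real L + 2)
        \<le> (real m - real m powr \<beta>) powr (- \<beta>) * (real m powr \<beta> + 2)"
      using L by (auto intro!: mult_left_mono)
    with lo up show ?thesis by linarith
  qed
  show "\<forall>\<^sub>F m in sequentially. (real m + 1) powr (- \<beta>) * (real m powr \<beta> + 1) \<le> mean_gain \<beta> m"
    using eventually_ge_at_top[of "2::nat"] by eventually_elim (use both in blast)
  show "\<forall>\<^sub>F m in sequentially. mean_gain \<beta> m \<le> (real m - real m powr \<beta>) powr (- \<beta>) * (real m powr \<beta> + 2)"
    using eventually_ge_at_top[of "2::nat"] by eventually_elim (use both in blast)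
qed

lemma mean_typical_height:
  assumes "m \<ge> 1"
  shows "(\<Sum>v\<in>window \<beta> m. typical_height \<beta> v) / real (card (window \<beta> m))
       = typical_height \<beta> (Suc m) - mean_gain \<beta> m"
  using card_window_pos[OF assms, of \<beta>] window_nonempty[OF assms, of \<beta>]
  by (simp add: mean_gain_def sum_subtractf diff_divide_distrib)

lemma exp_le_quadratic:
  fixes x :: real
  assumes "\<bar>x\<bar> \<le> 1"
  shows "exp x \<le> 1 + x + x\<^sup>2"
proof (cases "x \<ge> 0")
  case True
  then show ?thesis using assms exp_bound by auto
next
  case False
  have "exp x * (1 - x) \<le> exp x * exp (- x)"
    using exp_ge_add_one_self[of "- x"] by (intro mult_left_mono) auto
  then have "exp x * (1 - x) \<le> 1" by (simp flip: exp_add)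
  also have "1 \<le> (1 + x + x\<^sup>2) * (1 - x)"
    using False mult_nonpos_nonneg[of x "x * x"] by (simp add: algebra_simps power2_eq_square)
  finally show ?thesis using False by (simp add: mult_le_cancel_right)
qed

text \<open>The supersolution property of \<open>exp (l * g v)\<close> for the recursion of the exponential moments. The constants:
  \<open>\<bar>l\<bar> \<le> 2 * \<bar>s\<bar>\<close> and \<open>g\<close> varies by at most 3 over the window, so the quadratic error is at most
  \<open>9 * l\<^sup>2 \<le> 36 * s\<^sup>2 \<le> \<epsilon> * \<bar>s\<bar> / 2\<close>. The deviation of the mean gain from 1, at most \<open>\<epsilon> / 4\<close>, costs the same amount.
  Together they use up the surplus \<open>\<epsilon> * \<bar>s\<bar>\<close> of \<open>l\<close> over \<open>s\<close>.\<close>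

lemma eventually_exponential_step:
  fixes \<epsilon> s :: real
  assumes \<beta>: "0 < \<beta>" "\<beta> < 1" and \<epsilon>: "0 < \<epsilon>" "\<epsilon> \<le> 1" and s: "\<bar>s\<bar> \<le> \<epsilon> / 72"
  defines "l \<equiv> s + \<epsilon> * \<bar>s\<bar>"
  shows "\<forall>\<^sub>F m in sequentially.
    exp s * ((\<Sum>v\<in>window \<beta> m. exp (l * typical_height \<beta> v)) / real (card (window \<beta> m)))
      \<le> exp (l * typical_height \<beta> (Suc m))"
proof -
  have "\<epsilon> * \<bar>s\<bar> \<le> \<bar>s\<bar>" using \<epsilon> by (simp add: mult_left_le_one_le)
  then have l: "\<bar>l\<bar> \<le> 2 * \<bar>s\<bar>" 
    unfolding l_def using \<epsilon> by (smt (verit) zero_le_mult_iff)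
  have "\<forall>\<^sub>F m in sequentially. \<bar>mean_gain \<beta> m - 1\<bar> < \<epsilon> / 4"
    using tendstoD[OF mean_gain_tendsto[OF \<beta>], of "\<epsilon> / 4"] \<epsilon> by (simp add: dist_real_def)
  then show ?thesis
    using eventually_gap_bounds[OF \<beta>] eventually_ge_at_top[of "1::nat"]
  proof eventually_elim
    case (elim m)
    let ?W = "window \<beta> m" and ?g = "typical_height \<beta>"
    have card: "real (card ?W) > 0" using card_window_pos[OF elim(3)] by simp
    have "exp (l * ?g v) \<le> exp (l * ?g (Suc m)) * (1 - l * (?g (Suc m) - ?g v) + 9 * l\<^sup>2)"
      if "v \<in> ?W" for v
    proof -
      let ?x = "- l * (?g (Suc m) - ?g v)"
      have d: "0 \<le> ?g (Suc m) - ?g v" "?g (Suc m) - ?g v \<le> 3" using elim(2) that by auto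
      have "\<bar>?x\<bar> = \<bar>l\<bar> * (?g (Suc m) - ?g v)" using d by (simp add: abs_mult)
      also have le: "\<dots> \<le> \<bar>l\<bar> * 3" using d by (intro mult_left_mono) auto
      finally have x3: "\<bar>?x\<bar> \<le> \<bar>3 * l\<bar>" by simp
      then have "\<bar>?x\<bar> \<le> 1" using l s \<epsilon> by linarith
      then have "exp ?x \<le> 1 + ?x + ?x\<^sup>2" by (rule exp_le_quadratic)
      also have "?x\<^sup>2 \<le> (3 * l)\<^sup>2" using x3 by (simp only: abs_le_square_iff)
      finally have "exp ?x \<le> 1 - l * (?g (Suc m) - ?g v) + 9 * l\<^sup>2" by (simp add: power_mult_distrib)
      then have "exp (l * ?g (Suc m)) * exp ?x
          \<le> exp (l * ?g (Suc m)) * (1 - l * (?g (Suc m) - ?g v) + 9 * l\<^sup>2)"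
        by (intro mult_left_mono) auto
      then show ?thesis by (simp add: algebra_simps flip: exp_add)
    qed
    then have "(\<Sum>v\<in>?W. exp (l * ?g v))
        \<le> (\<Sum>v\<in>?W. exp (l * ?g (Suc m)) * (1 - l * (?g (Suc m) - ?g v) + 9 * l\<^sup>2))"
      by (rule sum_mono)
    also have "\<dots> = exp (l * ?g (Suc m)) * (real (card ?W) * (1 - l * mean_gain \<beta> m + 9 * l\<^sup>2))"
    proof -
      define D where "D v = ?g (Suc m) - ?g v" for v
      have "(\<Sum>v\<in>?W. D v) = real (card ?W) * mean_gain \<beta> m"
        using card by (simp add: mean_gain_def D_def)
      then have "(\<Sum>v\<in>?W. 1 - l * D v + 9 * l\<^sup>2) = real (card ?W) * (1 - l * mean_gain \<beta> m + 9 * l\<^sup>2)"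
        by (simp add: sum.distrib sum_subtractf sum_distrib_left[symmetric] algebra_simps)
      then show ?thesis by (simp add: sum_distrib_left[symmetric] D_def)
    qed
    finally have "(\<Sum>v\<in>?W. exp (l * ?g v)) / real (card ?W)
        \<le> exp (l * ?g (Suc m)) * (1 - l * mean_gain \<beta> m + 9 * l\<^sup>2)"
      using card by (simp only: pos_divide_le_eq ac_simps)
    also have "\<dots> \<le> exp (l * ?g (Suc m)) * exp (- s)"
    proof (intro mult_left_mono)
      have "\<bar>l * (mean_gain \<beta> m - 1)\<bar> \<le> (2 * \<bar>s\<bar>) * (\<epsilon> / 4)"
        unfolding abs_mult using l elim(1) by (intro mult_mono) auto
      moreover have "9 * l\<^sup>2 \<le> \<epsilon> * \<bar>s\<bar> / 2"
      proof -
        have "\<bar>l\<bar>\<^sup>2 \<le> (2 * \<bar>s\<bar>)\<^sup>2" using l by (intro power_mono) auto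
        then have "l\<^sup>2 \<le> (2 * \<bar>s\<bar>)\<^sup>2" by simp
        also have "\<dots> = 4 * \<bar>s\<bar> * \<bar>s\<bar>" by (simp add: power2_eq_square)
        also have "\<dots> \<le> 4 * \<bar>s\<bar> * (\<epsilon> / 72)" using s by (intro mult_left_mono) auto
        finally show ?thesis by simp
      qed
      moreover have "l * mean_gain \<beta> m = s + \<epsilon> * \<bar>s\<bar> + l * (mean_gain \<beta> m - 1)"
        by (simp add: l_def algebra_simps)
      moreover have "(2 * \<bar>s\<bar>) * (\<epsilon> / 4) = \<epsilon> * \<bar>s\<bar> / 2" by simp
      ultimately have "1 - l * mean_gain \<beta> m + 9 * l\<^sup>2 \<le> 1 + (- s)" by linarith
      also have "\<dots> \<le> exp (- s)" by (rule exp_ge_add_one_self)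
      finally show "1 - l * mean_gain \<beta> m + 9 * l\<^sup>2 \<le> exp (- s)" .
    qed simp
    finally have "exp s * ((\<Sum>v\<in>?W. exp (l * ?g v)) / real (card ?W))
        \<le> exp s * (exp (l * ?g (Suc m)) * exp (- s))"
      by (intro mult_left_mono) auto
    also have "\<dots> = exp (l * ?g (Suc m))" by (simp flip: exp_add)
    finally show ?case .
  qed
qed

text \<open>A comparison principle by induction; the constant \<open>K\<close> absorbs the finitely many \<open>m\<close> for which \<open>w\<close> is not yet a
  supersolution.\<close>

lemma supersolution_bound:
  fixes x w :: "nat \<Rightarrow> real" and a :: real
  assumes x: "\<And>v. 0 \<le> x v" and w: "\<And>v. 0 < w v" and "0 \<le> a"
    and rec: "\<And>m. m \<ge> 1 \<Longrightarrow> x (Suc m) = a * ((\<Sum>v\<in>window \<beta> m. x v) / real (card (window \<beta> m)))"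
    and super: "\<forall>\<^sub>F m in sequentially.
      a * ((\<Sum>v\<in>window \<beta> m. w v) / real (card (window \<beta> m))) \<le> w (Suc m)"
  shows "\<exists>K>0. \<forall>v\<ge>1. x v \<le> K * w v"
proof -
  obtain m0 where m0: "\<And>m. m \<ge> m0 \<Longrightarrow>
      a * ((\<Sum>v\<in>window \<beta> m. w v) / real (card (window \<beta> m))) \<le> w (Suc m)"
    using super by (auto simp: eventually_sequentially)
  define K where "K = 1 + (\<Sum>v\<le>Suc m0. x v / w v)"
  have nonneg: "0 \<le> x v / w v" for v using x w[of v] by simp
  then have "0 \<le> (\<Sum>v\<le>Suc m0. x v / w v)" by (intro sum_nonneg) auto
  then have K: "K > 0" unfolding K_def by linarith
  have "x v \<le> K * w v" if "v \<ge> 1" for v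
    using that
  proof (induction v rule: less_induct)
    case (less v)
    show ?case
    proof (cases "v \<le> Suc m0")
      case True
      have "x v / w v \<le> (\<Sum>v\<le>Suc m0. x v / w v)"
        using True nonneg by (intro member_le_sum) auto
      then have "x v / w v \<le> K" by (simp add: K_def)
      then show ?thesis using w[of v] by (simp add: pos_divide_le_eq)
    next
      case False
      then obtain m where m: "v = Suc m" "m \<ge> 1" "m \<ge> m0" using less.prems False by (cases v) auto
      have "(\<Sum>v\<in>window \<beta> m. x v) \<le> (\<Sum>v\<in>window \<beta> m. K * w v)"
        using m window_subset[of \<beta> m] by (intro sum_mono less.IH) auto
      then have "x v \<le> a * ((\<Sum>v\<in>window \<beta> m. K * w v) / real (card (window \<beta> m)))"
        unfolding m(1) rec[OF m(2)] using \<open>0 \<le> a\<close> by (intro mult_left_mono divide_right_mono) auto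
      also have "\<dots> = K * (a * ((\<Sum>v\<in>window \<beta> m. w v) / real (card (window \<beta> m))))"
        by (simp add: sum_distrib_left[symmetric])
      also have "\<dots> \<le> K * w v" unfolding m(1) using m0[OF m(3)] K by (intro mult_left_mono) auto
      finally show ?thesis .
    qed
  qed
  with K show ?thesis by blast
qed

section \<open>Means along random lineages\<close>

locale mesoscopic_tree = limited_memory_process M "mesoscopic \<beta>" p
  for M :: "'a measure" and \<beta> :: real and p :: "nat \<Rightarrow> 'a \<Rightarrow> nat" +
  assumes \<beta>: "1 / 2 < \<beta>" "\<beta> < 1"
begin

text \<open>The choices of the vertices \<open>2, \<dots>, m\<close> are \<open>p 1, \<dots>, p (m - 1)\<close>. Quantities that depend on these alone are
  independent of \<open>p m\<close>, the choice of vertex \<open>m + 1\<close>.\<close>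

definition depends_below :: "nat \<Rightarrow> ((nat \<Rightarrow> nat) \<Rightarrow> 'b) \<Rightarrow> bool" where
  "depends_below m F \<longleftrightarrow> (\<forall>q q'. (\<forall>i\<in>{1..<m}. q i = q' i) \<longrightarrow> F q = F q')"

abbreviation choices :: "'a \<Rightarrow> nat \<Rightarrow> nat" where
  "choices \<omega> \<equiv> \<lambda>i. p i \<omega>"

lemma measurable_choice [measurable]: "m \<ge> 1 \<Longrightarrow> p m \<in> measurable M (count_space UNIV)"
  using indep_choices by (auto simp: indep_vars_def)

lemma AE_choice: "m \<ge> 1 \<Longrightarrow> AE \<omega> in M. p m \<omega> \<in> window \<beta> m"
proof -
  assume m: "m \<ge> 1"
  have "AE x in measure_pmf (pmf_of_set (window \<beta> m)). x \<in> window \<beta> m"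
    using set_pmf_of_set[OF window_nonempty[OF m, of \<beta>]] by (simp add: AE_measure_pmf_iff)
  then have "AE x in distr M (count_space UNIV) (p m). x \<in> window \<beta> m"
    unfolding uniform_choices[OF m, folded window_def] .
  then show ?thesis using measurable_choice[OF m] by (simp add: AE_distr_iff)
qed

lemma AE_choices: "AE \<omega> in M. \<forall>m\<in>{1..<n}. p m \<omega> \<in> {1..m}"
proof (rule AE_ball_countable')
  fix m :: nat assume "m \<in> {1..<n}"
  then have "AE \<omega> in M. p m \<omega> \<in> window \<beta> m" by (intro AE_choice) auto
  then show "AE \<omega> in M. p m \<omega> \<in> {1..m}"
    by eventually_elim (use window_subset in blast)
qed auto

lemma prob_choice:
  assumes "m \<ge> 1" "v \<in> window \<beta> m"
  shows "prob {\<omega> \<in> space M. p m \<omega> = v} = 1 / real (card (window \<beta> m))"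
proof -
  have "prob {\<omega> \<in> space M. p m \<omega> = v} = measure (distr M (count_space UNIV) (p m)) {v}"
    using measurable_choice[OF assms(1)]
    by (subst measure_distr) (auto intro!: arg_cong[where f = prob])
  also have "\<dots> = pmf (pmf_of_set (window \<beta> m)) v"
    using uniform_choices[OF assms(1)] by (simp add: window_def measure_pmf_single)
  finally show ?thesis using assms window_nonempty[OF assms(1), of \<beta>] by simp
qed

lemma depends_below_restrict:
  "depends_below m F \<Longrightarrow> F q = F (restrict q {1..<m})"
  by (auto simp: depends_below_def)

text \<open>Finitely many choices take countably many values, so every function of them is measurable.\<close>

lemma measurable_from_choices:
  "F \<in> UNIV \<rightarrow> space N \<Longrightarrow> F \<in> measurable (PiM {1..<m::nat} (\<lambda>_. count_space (UNIV :: nat set))) N"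
  by (subst count_space_PiM_finite) auto

lemma measurable_depends_below:
  assumes "depends_below m F" "F \<in> UNIV \<rightarrow> space N"
  shows "(\<lambda>\<omega>. F (choices \<omega>)) \<in> measurable M N"
proof -
  have "(\<lambda>\<omega>. restrict (choices \<omega>) {1..<m}) \<in> measurable M (PiM {1..<m} (\<lambda>_. count_space UNIV))"
    by (intro measurable_restrict measurable_choice) auto
  then have "(\<lambda>\<omega>. F (restrict (choices \<omega>) {1..<m})) \<in> measurable M N"
    using measurable_from_choices[OF assms(2)] by (rule measurable_compose)
  then show ?thesis unfolding depends_below_restrict[OF assms(1), symmetric] .
qed

lemma integrable_depends_below:
  fixes F :: "(nat \<Rightarrow> nat) \<Rightarrow> real"
  assumes "depends_below m F" "\<And>q. \<bar>F q\<bar> \<le> B"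
  shows "integrable M (\<lambda>\<omega>. F (choices \<omega>))"
  using assms measurable_depends_below[OF assms(1), of borel]
  by (intro integrable_const_bound[where B = B]) auto

text \<open>Conditioning on the parent of \<open>m + 1\<close>. All recursions for means along lineages are instances of this identity, with
  \<open>G\<close> a functional of the lineage of \<open>m + 1\<close> that becomes \<open>F v\<close> once the parent is known to be \<open>v\<close>.\<close>

lemma expectation_at_choice:
  fixes F :: "nat \<Rightarrow> (nat \<Rightarrow> nat) \<Rightarrow> real"
  assumes m: "m \<ge> 1" and dep: "\<And>v. v \<in> window \<beta> m \<Longrightarrow> depends_below m (F v)"
    and bound: "\<And>v q. v \<in> window \<beta> m \<Longrightarrow> \<bar>F v q\<bar> \<le> B"
    and G: "depends_below (Suc m) G" "\<And>q. q m \<in> window \<beta> m \<Longrightarrow> G q = F (q m) q"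
  shows "expectation (\<lambda>\<omega>. G (choices \<omega>))
       = (\<Sum>v\<in>window \<beta> m. expectation (\<lambda>\<omega>. F v (choices \<omega>))) / real (card (window \<beta> m))"
proof -
  let ?ind = "\<lambda>v \<omega>. indicat_real {v} (p m \<omega>)"
  have prod: "integrable M (\<lambda>\<omega>. ?ind v \<omega> * F v (choices \<omega>)) \<and>
    expectation (\<lambda>\<omega>. ?ind v \<omega> * F v (choices \<omega>))
      = expectation (\<lambda>\<omega>. F v (choices \<omega>)) / real (card (window \<beta> m))"
    if v: "v \<in> window \<beta> m" for v
  proof -
    have "indep_var (PiM {m} (\<lambda>_. count_space UNIV)) (\<lambda>\<omega>. restrict (choices \<omega>) {m})
       (PiM {1..<m} (\<lambda>_. count_space UNIV)) (\<lambda>\<omega>. restrict (choices \<omega>) {1..<m})"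
      using m by (intro indep_var_restrict[OF indep_choices]) auto
    moreover have "(\<lambda>q. indicat_real {v} (q m)) \<in> borel_measurable (PiM {m} (\<lambda>_. count_space UNIV))"
      by (rule measurable_compose[OF measurable_component_singleton]) auto
    moreover have "F v \<in> borel_measurable (PiM {1..<m} (\<lambda>_. count_space UNIV))"
      by (rule measurable_from_choices) auto
    ultimately have "indep_var borel ((\<lambda>q. indicat_real {v} (q m)) \<circ> (\<lambda>\<omega>. restrict (choices \<omega>) {m}))
       borel (F v \<circ> (\<lambda>\<omega>. restrict (choices \<omega>) {1..<m}))"
      by (rule indep_var_compose)
    moreover have "F v (restrict (choices \<omega>) {1..<m}) = F v (choices \<omega>)" for \<omega>
      using depends_below_restrict[OF dep[OF v]] by metis
    ultimately have indep: "indep_var borel (?ind v) borel (\<lambda>\<omega>. F v (choices \<omega>))"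
      by (simp add: comp_def)
    have "?ind v \<in> borel_measurable M"
      using measurable_choice[OF m] by (rule measurable_compose) auto
    then have int1: "integrable M (?ind v)"
      by (intro integrable_const_bound[where B = 1]) auto
    have int2: "integrable M (\<lambda>\<omega>. F v (choices \<omega>))"
      using dep[OF v] bound[OF v] by (rule integrable_depends_below)
    have "expectation (?ind v) = expectation (indicat_real {\<omega> \<in> space M. p m \<omega> = v})"
      by (intro Bochner_Integration.integral_cong) (auto simp: indicator_def)
    also have "\<dots> = 1 / real (card (window \<beta> m))"
      using prob_choice[OF m v] measurable_choice[OF m] by simp
    finally show ?thesis
      using indep_var_integrable[OF indep int1 int2] indep_var_lebesgue_integral[OF indep int1 int2]
      by simp
  qed
  have "expectation (\<lambda>\<omega>. G (choices \<omega>))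
      = expectation (\<lambda>\<omega>. \<Sum>v\<in>window \<beta> m. ?ind v \<omega> * F v (choices \<omega>))"
  proof (rule integral_cong_AE)
    show "AE \<omega> in M. G (choices \<omega>) = (\<Sum>v\<in>window \<beta> m. ?ind v \<omega> * F v (choices \<omega>))"
      using AE_choice[OF m]
    proof eventually_elim
      case (elim \<omega>)
      have "(\<Sum>v\<in>window \<beta> m. ?ind v \<omega> * F v (choices \<omega>))
          = (\<Sum>v\<in>window \<beta> m. if v = p m \<omega> then F v (choices \<omega>) else 0)"
        by (intro sum.cong) auto
      with elim show ?case using G(2)[of "choices \<omega>"] by simp
    qed
    show "(\<lambda>\<omega>. G (choices \<omega>)) \<in> borel_measurable M"
      using G(1) by (rule measurable_depends_below) auto
    show "(\<lambda>\<omega>. \<Sum>v\<in>window \<beta> m. ?ind v \<omega> * F v (choices \<omega>)) \<in> borel_measurable M"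
      using prod by (intro borel_measurable_sum borel_measurable_integrable) blast
  qed
  also have "\<dots> = (\<Sum>v\<in>window \<beta> m. expectation (\<lambda>\<omega>. ?ind v \<omega> * F v (choices \<omega>)))"
    using prod by (intro Bochner_Integration.integral_sum) auto
  also have "\<dots> = (\<Sum>v\<in>window \<beta> m. expectation (\<lambda>\<omega>. F v (choices \<omega>))) / real (card (window \<beta> m))"
    using prod by (simp add: sum_divide_distrib)
  finally show ?thesis .
qed

lemma depends_below_lineage: "v \<le> m \<Longrightarrow> depends_below m (\<lambda>q. f (lineage q v))"
  unfolding depends_below_def using lineage_cong[of v] by (metis atLeastLessThan_iff order_less_le_trans)

lemma depends_below_lineage2:
  "v \<le> m \<Longrightarrow> w \<le> m \<Longrightarrow> depends_below m (\<lambda>q. f (lineage q v) (lineage q w))"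
  unfolding depends_below_def using lineage_cong[of v] lineage_cong[of w]
  by (metis atLeastLessThan_iff order_less_le_trans)

lemma lineage_Suc_window:
  "m \<ge> 1 \<Longrightarrow> q m \<in> window \<beta> m \<Longrightarrow> lineage q (Suc m) = insert (Suc m) (lineage q (q m))"
  using window_subset[of \<beta> m] by (intro lineage_Suc) auto

lemma Suc_notin_lineage: "v \<le> m \<Longrightarrow> Suc m \<notin> lineage q v"
  using lineage_subset[of q v] by auto

lemma card_lineage_Suc_window:
  assumes "m \<ge> 1" "q m \<in> window \<beta> m"
  shows "card (lineage q (Suc m)) = Suc (card (lineage q (q m)))"
  using lineage_Suc_window[of m q, OF assms] Suc_notin_lineage[of "q m" m q] window_subset[of \<beta> m] assms
  by auto

lemma exponential_recursion:
  assumes m: "m \<ge> 1"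
  shows "expectation (\<lambda>\<omega>. exp (s * real (card (lineage (choices \<omega>) (Suc m)))))
    = exp s * ((\<Sum>v\<in>window \<beta> m. expectation (\<lambda>\<omega>. exp (s * real (card (lineage (choices \<omega>) v)))))
        / real (card (window \<beta> m)))"
proof -
  have "expectation (\<lambda>\<omega>. exp (s * real (card (lineage (choices \<omega>) (Suc m)))))
    = (\<Sum>v\<in>window \<beta> m. expectation (\<lambda>\<omega>. exp s * exp (s * real (card (lineage (choices \<omega>) v)))))
        / real (card (window \<beta> m))"
  proof (rule expectation_at_choice[OF m])
    fix v assume v: "v \<in> window \<beta> m"
    then have "v \<le> m" using window_subset by fastforce
    then show "depends_below m (\<lambda>q. exp s * exp (s * real (card (lineage q v))))"
      by (rule depends_below_lineage)
    fix q
    have "s * real (card (lineage q v)) \<le> \<bar>s\<bar> * real m"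
      using card_lineage_le[of q v] \<open>v \<le> m\<close> by (intro mult_mono) auto
    then show "\<bar>exp s * exp (s * real (card (lineage q v)))\<bar> \<le> exp s * exp (\<bar>s\<bar> * real m)"
      by (simp add: abs_mult)
  next
    show "depends_below (Suc m) (\<lambda>q. exp (s * real (card (lineage q (Suc m)))))"
      by (rule depends_below_lineage) simp
    show "exp (s * real (card (lineage q (Suc m)))) = exp s * exp (s * real (card (lineage q (q m))))"
      if "q m \<in> window \<beta> m" for q
      using card_lineage_Suc_window[of m q, OF m that] by (simp add: algebra_simps flip: exp_add)
  qed
  then show ?thesis by (simp flip: sum_distrib_left)
qed

lemma exponential_moment_bound:
  assumes "0 < \<epsilon>" "\<epsilon> \<le> 1" "\<bar>s\<bar> \<le> \<epsilon> / 72"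
  shows "\<exists>K>0. \<forall>v\<ge>1. expectation (\<lambda>\<omega>. exp (s * real (card (lineage (choices \<omega>) v))))
    \<le> K * exp ((s + \<epsilon> * \<bar>s\<bar>) * typical_height \<beta> v)"
  using \<beta> assms
  by (intro supersolution_bound[where a = "exp s" and \<beta> = \<beta>] exponential_recursion eventually_exponential_step) auto

lemma integrable_lineage:
  fixes f :: "nat set \<Rightarrow> nat set \<Rightarrow> real"
  assumes "\<And>q. \<bar>f (lineage q u) (lineage q v)\<bar> \<le> B"
  shows "integrable M (\<lambda>\<omega>. f (lineage (choices \<omega>) u) (lineage (choices \<omega>) v))"
  by (rule integrable_depends_below[OF depends_below_lineage2[of u "max u v" v f] assms]) auto

text \<open>On the diagonal this is the mean height.\<close>

abbreviation common_mean :: "nat \<Rightarrow> nat \<Rightarrow> real" where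
  "common_mean u v \<equiv> expectation (\<lambda>\<omega>. real (card (lineage (choices \<omega>) u \<inter> lineage (choices \<omega>) v)))"

lemma card_common_le: "card (lineage q u \<inter> lineage q v) \<le> u"
  using card_mono[of "lineage q u" "lineage q u \<inter> lineage q v"] card_lineage_le[of q u] by simp

lemma integrable_common:
  "integrable M (\<lambda>\<omega>. real (card (lineage (choices \<omega>) u \<inter> lineage (choices \<omega>) v)))"
  using card_common_le by (intro integrable_lineage[where B = "real u"]) auto

lemma common_mean_le: "common_mean u v \<le> real u"
proof -
  have "common_mean u v \<le> expectation (\<lambda>\<omega>. real u)"
    using integrable_common card_common_le by (intro integral_mono) auto
  then show ?thesis by (simp add: prob_space)
qed

lemma common_mean_commute: "common_mean u v = common_mean v u"
  by (simp add: Int_commute)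

lemma height_mean_recursion:
  assumes m: "m \<ge> 1"
  shows "common_mean (Suc m) (Suc m)
    = 1 + (\<Sum>v\<in>window \<beta> m. common_mean v v) / real (card (window \<beta> m))"
proof -
  have add_one: "expectation (\<lambda>\<omega>. 1 + real (card (lineage (choices \<omega>) v \<inter> lineage (choices \<omega>) v)))
     = 1 + common_mean v v" for v
    by (subst Bochner_Integration.integral_add) (use integrable_common[of v v] in \<open>auto simp: prob_space\<close>)
  have "common_mean (Suc m) (Suc m)
    = (\<Sum>v\<in>window \<beta> m. expectation (\<lambda>\<omega>. 1 + real (card (lineage (choices \<omega>) v \<inter> lineage (choices \<omega>) v))))
        / real (card (window \<beta> m))"
  proof (rule expectation_at_choice[OF m])
    fix v assume v: "v \<in> window \<beta> m"
    then have "v \<le> m" using window_subset by fastforce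
    then show "depends_below m (\<lambda>q. 1 + real (card (lineage q v \<inter> lineage q v)))"
      by (rule depends_below_lineage)
    show "\<bar>1 + real (card (lineage q v \<inter> lineage q v))\<bar> \<le> 1 + real m" for q
      using card_lineage_le[of q v] \<open>v \<le> m\<close> by simp
  next
    show "depends_below (Suc m) (\<lambda>q. real (card (lineage q (Suc m) \<inter> lineage q (Suc m))))"
      by (rule depends_below_lineage) simp
    show "real (card (lineage q (Suc m) \<inter> lineage q (Suc m)))
        = 1 + real (card (lineage q (q m) \<inter> lineage q (q m)))" if "q m \<in> window \<beta> m" for q
      using card_lineage_Suc_window[of m q, OF m that] by simp
  qed
  also have "(\<Sum>v\<in>window \<beta> m. expectation (\<lambda>\<omega>. 1 + real (card (lineage (choices \<omega>) v \<inter> lineage (choices \<omega>) v))))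
     = real (card (window \<beta> m)) + (\<Sum>v\<in>window \<beta> m. common_mean v v)"
    unfolding add_one by (simp only: sum.distrib) simp
  finally show ?thesis using card_window_pos[OF m, of \<beta>]
      window_nonempty[OF m, of \<beta>]
    by (simp only: add_divide_distrib) simp
qed

text \<open>Only the younger vertex moves: \<open>m + 1\<close> itself is not an ancestor of \<open>v\<close>.\<close>

lemma common_mean_recursion:
  assumes m: "m \<ge> 1" and v: "v \<le> m"
  shows "common_mean (Suc m) v = (\<Sum>w\<in>window \<beta> m. common_mean w v) / real (card (window \<beta> m))"
proof (rule expectation_at_choice[OF m])
  fix w assume w: "w \<in> window \<beta> m"
  then have "w \<le> m" using window_subset by fastforce
  then show "depends_below m (\<lambda>q. real (card (lineage q w \<inter> lineage q v)))"
    using v by (rule depends_below_lineage2)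
  show "\<bar>real (card (lineage q w \<inter> lineage q v))\<bar> \<le> real m" for q
    using card_common_le[of q w v] \<open>w \<le> m\<close> by simp
next
  show "depends_below (Suc m) (\<lambda>q. real (card (lineage q (Suc m) \<inter> lineage q v)))"
    using v by (intro depends_below_lineage2) auto
  show "real (card (lineage q (Suc m) \<inter> lineage q v)) = real (card (lineage q (q m) \<inter> lineage q v))"
    if "q m \<in> window \<beta> m" for q
    using lineage_Suc_window[of m q, OF m that] Suc_notin_lineage[OF v, of q] by simp
qed

lemma eventually_mean_gain: "\<forall>\<^sub>F m in sequentially. 1 / 2 < mean_gain \<beta> m"
  using mean_gain_tendsto \<beta> by (intro order_tendstoD[where y = 1]) auto

lemma typical_height_nonneg: "0 \<le> typical_height \<beta> v"
  using \<beta> by (simp add: typical_height_def)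

lemma typical_height_mono: "u \<le> v \<Longrightarrow> typical_height \<beta> u \<le> typical_height \<beta> v"
  using \<beta> by (auto simp: typical_height_def intro!: divide_right_mono mult_left_mono powr_mono2)

text \<open>The factor 2 leaves room for the mean gain, which is only eventually close to 1: a gain of
  \<open>1 / 2\<close> already pays for the step to the parent.\<close>

lemma height_mean_bound: "\<exists>K\<ge>0. \<forall>v. common_mean v v \<le> 2 * typical_height \<beta> v + K"
proof -
  obtain m0 where m0: "\<And>m. m \<ge> m0 \<Longrightarrow> 1 / 2 < mean_gain \<beta> m"
    using eventually_mean_gain by (auto simp: eventually_sequentially)
  have "common_mean v v \<le> 2 * typical_height \<beta> v + real (Suc m0)" for v
  proof (induction v rule: less_induct)
    case (less v)
    show ?case
    proof (cases "v \<le> Suc m0")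
      case True
      then show ?thesis using common_mean_le[of v v] typical_height_nonneg[of v] by linarith
    next
      case False
      then obtain m where m: "v = Suc m" "m \<ge> m0" "m \<ge> 1" by (cases v) auto
      have card: "real (card (window \<beta> m)) > 0" using card_window_pos[OF m(3)] by simp
      have "(\<Sum>v\<in>window \<beta> m. common_mean v v)
          \<le> (\<Sum>v\<in>window \<beta> m. 2 * typical_height \<beta> v + real (Suc m0))"
        using m window_subset[of \<beta> m] by (intro sum_mono less.IH) auto
      also have "\<dots> = 2 * (\<Sum>v\<in>window \<beta> m. typical_height \<beta> v) + real (card (window \<beta> m)) * real (Suc m0)"
        by (simp add: sum.distrib sum_distrib_left)
      finally have "(\<Sum>v\<in>window \<beta> m. common_mean v v) / real (card (window \<beta> m))
          \<le> (2 * (\<Sum>v\<in>window \<beta> m. typical_height \<beta> v) + real (card (window \<beta> m)) * real (Suc m0))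
             / real (card (window \<beta> m))"
        by (intro divide_right_mono) auto
      also have "\<dots> = 2 * (typical_height \<beta> (Suc m) - mean_gain \<beta> m) + real (Suc m0)"
        unfolding mean_typical_height[OF m(3), symmetric] using card window_nonempty[OF m(3), of \<beta>]
        by (simp add: add_divide_distrib)
      finally show ?thesis
        unfolding m(1) height_mean_recursion[OF m(3)] using m0[OF m(2)] by argo
    qed
  qed
  then show ?thesis by (intro exI[of _ "real (Suc m0)"]) auto
qed

text \<open>Induction on the larger vertex. When it steps onto the smaller vertex \<open>v\<close>, with probability at most
  \<open>m powr (- \<beta>)\<close>, the whole lineage of \<open>v\<close> becomes common, of mean size at most \<open>2 * g m + H\<close>. For \<open>\<beta> > 1 / 2\<close> the product
  is eventually below \<open>\<delta> / 2\<close>, and the mean gain of \<open>\<delta> * g\<close> in the same step is at least \<open>\<delta> / 2\<close>.\<close>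

lemma common_mean_bound:
  assumes "\<delta> > 0"
  shows "\<exists>K. \<forall>u v. u \<noteq> v \<longrightarrow>
    common_mean u v \<le> \<delta> * (typical_height \<beta> u + typical_height \<beta> v) + K"
proof -
  let ?g = "typical_height \<beta>"
  obtain H where H: "H \<ge> 0" "\<And>v. common_mean v v \<le> 2 * ?g v + H" using height_mean_bound by blast
  have "(\<lambda>m. (2 * (2 / (1 - \<beta>) * real m powr (1 - \<beta>)) + H) / real m powr \<beta>) \<longlonglongrightarrow> 0"
    using \<beta> by real_asymp
  then have "\<forall>\<^sub>F m in sequentially. (2 * ?g m + H) / real m powr \<beta> < \<delta> / 2"
    unfolding typical_height_def using assms by (intro order_tendstoD[where y = 0]) auto
  with eventually_mean_gain eventually_ge_at_top[of "2::nat"]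
  have "\<forall>\<^sub>F m in sequentially. m \<ge> 2 \<and> 1 / 2 < mean_gain \<beta> m \<and> (2 * ?g m + H) / real m powr \<beta> < \<delta> / 2"
    by eventually_elim auto
  then obtain m0 where m0: "\<And>m. m \<ge> m0 \<Longrightarrow>
      m \<ge> 2 \<and> 1 / 2 < mean_gain \<beta> m \<and> (2 * ?g m + H) / real m powr \<beta> < \<delta> / 2"
    by (auto simp: eventually_sequentially)
  define K where "K = real (Suc m0)"
  have main: "common_mean u v \<le> \<delta> * (?g u + ?g v) + K" if "v < u" for u v
    using that
  proof (induction u arbitrary: v rule: less_induct)
    case (less u)
    show ?case
    proof (cases "u \<le> Suc m0")
      case True
      have "0 \<le> \<delta> * (?g u + ?g v)" using assms typical_height_nonneg by simp
      moreover have "common_mean u v \<le> K" using common_mean_le[of u v] True by (simp add: K_def)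
      ultimately show ?thesis by linarith
    next
      case False
      then obtain m where m: "u = Suc m" "m \<ge> m0" by (cases u) auto
      then have m1: "m \<ge> 1" and v: "v \<le> m" using m0[OF m(2)] less.prems by auto
      let ?W = "window \<beta> m"
      have card: "real (card ?W) > 0" using card_window_pos[OF m1] by simp
      have step: "common_mean w v
          \<le> \<delta> * (?g w + ?g v) + K + (if w = v then 2 * ?g m + H else 0)" if "w \<in> ?W" for w
      proof -
        have wm: "w \<le> m" using that window_subset[of \<beta> m] by auto
        consider "w = v" | "v < w" | "w < v" by linarith
        then show ?thesis
        proof cases
          case 1
          have "0 \<le> \<delta> * (?g w + ?g v) + K" using assms typical_height_nonneg by (simp add: K_def)
          then show ?thesis using H(2)[of v] typical_height_mono[OF v] 1 by simp
        next
          case 2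
          then show ?thesis using less.IH[of w v] wm m(1) by simp
        next
          case 3
          then show ?thesis using less.IH[of v w] v m(1) common_mean_commute[of w v]
            by (simp add: add.commute)
        qed
      qed
      have nonneg: "2 * ?g m + H \<ge> 0" using H(1) typical_height_nonneg by simp
      have "(\<Sum>w\<in>?W. common_mean w v)
          \<le> (\<Sum>w\<in>?W. \<delta> * (?g w + ?g v) + K + (if w = v then 2 * ?g m + H else 0))"
        by (intro sum_mono step)
      also have "\<dots> = \<delta> * (\<Sum>w\<in>?W. ?g w) + real (card ?W) * (\<delta> * ?g v + K)
          + (\<Sum>w\<in>?W. if w = v then 2 * ?g m + H else 0)"
        by (simp add: sum.distrib sum_distrib_left algebra_simps)
      also have "\<dots> \<le> \<delta> * (\<Sum>w\<in>?W. ?g w) + real (card ?W) * (\<delta> * ?g v + K) + (2 * ?g m + H)"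
        using nonneg by simp
      finally have "(\<Sum>w\<in>?W. common_mean w v) / real (card ?W)
          \<le> (\<delta> * (\<Sum>w\<in>?W. ?g w) + real (card ?W) * (\<delta> * ?g v + K) + (2 * ?g m + H)) / real (card ?W)"
        by (intro divide_right_mono) auto
      also have "\<dots> = \<delta> * (?g (Suc m) - mean_gain \<beta> m) + (\<delta> * ?g v + K) + (2 * ?g m + H) / real (card ?W)"
        unfolding mean_typical_height[OF m1, symmetric] using card window_nonempty[OF m1, of \<beta>]
        by (simp add: add_divide_distrib)
      also have "(2 * ?g m + H) / real (card ?W) \<le> (2 * ?g m + H) / real m powr \<beta>"
      proof -
        obtain L where "card ?W = L + 1" "real m powr \<beta> < real L + 1"
          using window_eq[of \<beta> m] \<beta> m0[OF m(2)] by (metis less_divide_eq_1_pos less_trans zero_less_divide_1_iff zero_less_numeral)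
        then show ?thesis using nonneg m1 by (intro divide_left_mono) auto
      qed
      finally have "common_mean u v
          \<le> \<delta> * (?g u - mean_gain \<beta> m) + (\<delta> * ?g v + K) + (2 * ?g m + H) / real m powr \<beta>"
        unfolding m(1) common_mean_recursion[OF m1 v] by simp
      also have "(2 * ?g m + H) / real m powr \<beta> \<le> \<delta> / 2" using m0[OF m(2)] by (intro less_imp_le) blast
      finally have "common_mean u v \<le> \<delta> * (?g u - mean_gain \<beta> m) + (\<delta> * ?g v + K) + \<delta> / 2"
        by simp
      moreover have "\<delta> * (1 / 2) \<le> \<delta> * mean_gain \<beta> m"
        using m0[OF m(2)] assms by (intro mult_left_mono) auto
      ultimately show ?thesis by (simp add: algebra_simps)
    qed
  qed
  have "common_mean u v \<le> \<delta> * (?g u + ?g v) + K" if "u \<noteq> v" for u v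
    using main[of u v] main[of v u] that common_mean_commute[of u v]
    by (cases "v < u") (auto simp: add.commute)
  then show ?thesis by blast
qed

end

section \<open>Heights, common ancestors and convergence to the star\<close>

text \<open>The scaling factor is the inverse of the typical height, and the \<open>i\<close>-th leg belongs to vertex \<open>n + 1 - i\<close>.\<close>

lemma latest_vertices_close_to_star:
  assumes "\<beta> < 1" and k: "1 \<le> k" "k \<le> n" and \<eta>: "0 < \<eta>" and large: "1 / \<eta> \<le> typical_height \<beta> n"
    and q: "\<forall>m\<in>{1..<n}. q m \<in> {1..m}"
    and height: "\<And>i. i \<in> {1..k} \<Longrightarrow>
      \<bar>real (card (lineage q (n + 1 - i))) / typical_height \<beta> n - 1\<bar> \<le> \<eta>"
    and common: "\<And>i j. i \<in> {1..k} \<Longrightarrow> j \<in> {1..k} \<Longrightarrow> i \<noteq> j \<Longrightarrow>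
      real (card (lineage q (n + 1 - i) \<inter> lineage q (n + 1 - j))) / typical_height \<beta> n \<le> \<eta>"
  shows "gromov_hausdorff_dist
      (scaled_graph_space ((1 - \<beta>) / 2 * real n powr (- (1 - \<beta>)))
        (spanned_subtree (recursive_tree q n) (insert 1 {v \<in> {1..n}. n < v + k})))
      (star_space k) \<le> ennreal (2 * \<eta>)"
proof -
  let ?g = "typical_height \<beta> n"
  define c where "c = (1 - \<beta>) / 2 * real n powr (- (1 - \<beta>))"
  have "0 < 1 / \<eta>" using \<eta> by simp
  with large have g: "?g > 0" by (rule less_le_trans[rotated])
  have "b / 2 * inverse x = 1 / (2 / b * x)" for b x :: real by (simp add: divide_simps)
  then have c: "c = 1 / ?g" unfolding c_def typical_height_def powr_minus .
  have "1 / ?g \<le> \<eta>" using large g \<eta> by (simp only: pos_divide_le_eq mult.commute)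
  then have c\<eta>: "0 < c" "c \<le> \<eta>" using g by (auto simp: c)
  let ?u = "\<lambda>i. n + 1 - i"
  have U: "{v \<in> {1..n}. n < v + k} = ?u ` {1..k}"
  proof (intro equalityI subsetI)
    fix v assume "v \<in> {v \<in> {1..n}. n < v + k}"
    then show "v \<in> ?u ` {1..k}" by (intro image_eqI[of _ _ "n + 1 - v"]) auto
  next
    fix v assume "v \<in> ?u ` {1..k}"
    then obtain i where "1 \<le> i" "i \<le> k" "v = n + 1 - i" by auto
    then show "v \<in> {v \<in> {1..n}. n < v + k}" using k by auto
  qed
  show ?thesis
    unfolding c_def[symmetric] U
  proof (rule spanned_subtree_close_to_star[OF q k(1) _ c\<eta>])
    show "?u i \<in> {1..n}" if "i \<in> {1..k}" for i using that k by auto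
    show "\<bar>c * real (card (lineage q (?u i))) - 1\<bar> \<le> \<eta>" if "i \<in> {1..k}" for i
      using height[OF that] unfolding c by simp
    show "c * real (card (lineage q (?u i) \<inter> lineage q (?u j))) \<le> \<eta>"
      if "i \<in> {1..k}" "j \<in> {1..k}" "i \<noteq> j" for i j
      using common[OF that] unfolding c by simp
  qed
qed

context mesoscopic_tree
begin

lemma measurable_lineage:
  fixes f :: "nat set \<Rightarrow> nat set \<Rightarrow> real"
  shows "(\<lambda>\<omega>. f (lineage (choices \<omega>) u) (lineage (choices \<omega>) v)) \<in> borel_measurable M"
  by (rule measurable_depends_below[OF depends_below_lineage2[of u "max u v" v f]]) auto

lemma filterlim_typical_height: "filterlim (typical_height \<beta>) at_top sequentially"
  unfolding typical_height_def using \<beta> by real_asymp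

abbreviation height :: "nat \<Rightarrow> 'a \<Rightarrow> real" where
  "height v \<omega> \<equiv> real (card (lineage (choices \<omega>) v))"

lemma measurable_height [measurable]: "height v \<in> borel_measurable M"
  using measurable_lineage[of "\<lambda>A _. real (card A)" v] by simp

lemma integrable_exp_height: "integrable M (\<lambda>\<omega>. exp (s * height v \<omega>))"
proof (rule integrable_lineage[of "\<lambda>A _. exp (s * real (card A))" v v "exp (\<bar>s\<bar> * real v)"])
  fix q
  have "s * real (card (lineage q v)) \<le> \<bar>s\<bar> * real v"
    using card_lineage_le[of q v] by (intro mult_mono) auto
  then show "\<bar>exp (s * real (card (lineage q v)))\<bar> \<le> exp (\<bar>s\<bar> * real v)" by simp
qed

text \<open>Chernoff bounds for both tails with the parameters \<open>s = \<theta>\<close> and \<open>s = - \<theta>\<close>. Since \<open>\<epsilon> \<le> \<eta> / 2\<close>, the loss \<open>\<epsilon> * \<bar>s\<bar>\<close> in the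
  exponential moment is at most half of the deviation \<open>\<eta> * \<bar>s\<bar>\<close>.\<close>

lemma height_concentration:
  assumes "\<eta> > 0"
  shows "(\<lambda>v. prob {\<omega> \<in> space M. \<bar>height v \<omega> / typical_height \<beta> v - 1\<bar> > \<eta>}) \<longlonglongrightarrow> 0"
proof -
  let ?g = "typical_height \<beta>"
  define \<epsilon> \<theta> where "\<epsilon> = min 1 (\<eta> / 2)" and "\<theta> = \<epsilon> / 72"
  have \<epsilon>: "0 < \<epsilon>" "\<epsilon> \<le> 1" "2 * \<epsilon> \<le> \<eta>" and \<theta>: "0 < \<theta>" using assms by (auto simp: \<epsilon>_def \<theta>_def)
  have tail: "\<exists>K. \<forall>v\<ge>1. prob {\<omega> \<in> space M. s * height v \<omega> \<ge> s * ?g v + \<bar>s\<bar> * \<eta> * ?g v}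
      \<le> K * exp (- (\<theta> * \<epsilon> * ?g v))" if s: "\<bar>s\<bar> = \<theta>" for s
  proof -
    obtain K where K: "K > 0" "\<And>v. v \<ge> 1 \<Longrightarrow>
        expectation (\<lambda>\<omega>. exp (s * height v \<omega>)) \<le> K * exp ((s + \<epsilon> * \<bar>s\<bar>) * ?g v)"
      using exponential_moment_bound[of \<epsilon> s] \<epsilon> s by (auto simp: \<theta>_def)
    have "prob {\<omega> \<in> space M. s * height v \<omega> \<ge> s * ?g v + \<bar>s\<bar> * \<eta> * ?g v} \<le> K * exp (- (\<theta> * \<epsilon> * ?g v))"
      if v: "v \<ge> 1" for v
    proof -
      let ?c = "exp (s * ?g v + \<bar>s\<bar> * \<eta> * ?g v)"
      have "prob {\<omega> \<in> space M. s * height v \<omega> \<ge> s * ?g v + \<bar>s\<bar> * \<eta> * ?g v}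
          = prob {\<omega> \<in> space M. exp (s * height v \<omega>) \<ge> ?c}" by simp
      also have "\<dots> \<le> expectation (\<lambda>\<omega>. exp (s * height v \<omega>)) / ?c"
        by (rule integral_Markov_inequality_measure[OF integrable_exp_height, of "{}"]) auto
      also have "\<dots> \<le> K * exp ((s + \<epsilon> * \<bar>s\<bar>) * ?g v) / ?c"
        using K(2)[OF v] by (intro divide_right_mono) auto
      also have "\<dots> = K * exp (\<theta> * (\<epsilon> - \<eta>) * ?g v)"
        unfolding times_divide_eq_right[symmetric] exp_diff[symmetric] using s
        by (simp add: algebra_simps)
      also have "\<dots> \<le> K * exp (- (\<theta> * \<epsilon> * ?g v))"
      proof -
        have "\<theta> * (2 * \<epsilon> - \<eta>) * ?g v \<le> 0"
          using \<theta> \<epsilon> typical_height_nonneg[of v] by (intro mult_nonpos_nonneg mult_nonneg_nonpos) auto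
        then show ?thesis using K(1) by (intro mult_left_mono) (auto simp: algebra_simps)
      qed
      finally show ?thesis .
    qed
    then show ?thesis by blast
  qed
  obtain K1 where K1: "\<And>v. v \<ge> 1 \<Longrightarrow> prob {\<omega> \<in> space M. \<theta> * height v \<omega> \<ge> \<theta> * ?g v + \<bar>\<theta>\<bar> * \<eta> * ?g v}
      \<le> K1 * exp (- (\<theta> * \<epsilon> * ?g v))" using tail[of \<theta>] \<theta> by auto
  obtain K2 where K2: "\<And>v. v \<ge> 1 \<Longrightarrow> prob {\<omega> \<in> space M. - \<theta> * height v \<omega> \<ge> - \<theta> * ?g v + \<bar>- \<theta>\<bar> * \<eta> * ?g v}
      \<le> K2 * exp (- (\<theta> * \<epsilon> * ?g v))" using tail[of "- \<theta>"] \<theta> by auto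
  show ?thesis
  proof (rule tendsto_sandwich[where f = "\<lambda>_. 0"])
    show "(\<lambda>v. (K1 + K2) * exp (- (\<theta> * \<epsilon> * ?g v))) \<longlonglongrightarrow> 0"
    proof -
      have "((\<lambda>x. (K1 + K2) * exp (- (\<theta> * \<epsilon> * x))) \<longlongrightarrow> 0) at_top"
        using \<theta> \<epsilon> by real_asymp
      then show ?thesis using filterlim_typical_height by (rule filterlim_compose)
    qed
    show "\<forall>\<^sub>F v in sequentially. prob {\<omega> \<in> space M. \<bar>height v \<omega> / ?g v - 1\<bar> > \<eta>}
        \<le> (K1 + K2) * exp (- (\<theta> * \<epsilon> * ?g v))"
      using eventually_ge_at_top[of "1::nat"]
    proof eventually_elim
      case (elim v)
      have g: "?g v > 0" using elim \<beta> by (simp add: typical_height_def)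
      let ?A = "{\<omega> \<in> space M. \<theta> * height v \<omega> \<ge> \<theta> * ?g v + \<bar>\<theta>\<bar> * \<eta> * ?g v}"
      let ?B = "{\<omega> \<in> space M. - \<theta> * height v \<omega> \<ge> - \<theta> * ?g v + \<bar>- \<theta>\<bar> * \<eta> * ?g v}"
      have meas: "?A \<in> events" "?B \<in> events" by measurable
      have "{\<omega> \<in> space M. \<bar>height v \<omega> / ?g v - 1\<bar> > \<eta>} \<subseteq> ?A \<union> ?B"
      proof
        fix \<omega> assume \<omega>: "\<omega> \<in> {\<omega> \<in> space M. \<bar>height v \<omega> / ?g v - 1\<bar> > \<eta>}"
        then have "height v \<omega> / ?g v \<ge> 1 + \<eta> \<or> height v \<omega> / ?g v \<le> 1 - \<eta>" by auto
        then have "height v \<omega> \<ge> (1 + \<eta>) * ?g v \<or> height v \<omega> \<le> (1 - \<eta>) * ?g v"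
          using g by (simp add: pos_le_divide_eq pos_divide_le_eq)
        then have "\<theta> * height v \<omega> \<ge> \<theta> * ((1 + \<eta>) * ?g v) \<or> \<theta> * height v \<omega> \<le> \<theta> * ((1 - \<eta>) * ?g v)"
          using \<theta> by simp
        then show "\<omega> \<in> ?A \<union> ?B" using \<omega> \<theta> by (auto simp: algebra_simps)
      qed
      then have "prob {\<omega> \<in> space M. \<bar>height v \<omega> / ?g v - 1\<bar> > \<eta>} \<le> prob (?A \<union> ?B)"
        using meas by (intro finite_measure_mono) auto
      also have "\<dots> \<le> prob ?A + prob ?B" using meas by (rule measure_Un_le)
      finally show ?case using K1[OF elim] K2[OF elim] by (simp add: distrib_right)
    qed
  qed auto
qed

lemma typical_height_shift: "(\<lambda>n. typical_height \<beta> (n + 1 - i) / typical_height \<beta> n) \<longlonglongrightarrow> 1"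
proof -
  have "(\<lambda>n. (1 + real n - real i) powr (1 - \<beta>) / real n powr (1 - \<beta>)) \<longlonglongrightarrow> 1"
    using \<beta> by real_asymp
  moreover have "\<forall>\<^sub>F n in sequentially. (1 + real n - real i) powr (1 - \<beta>) / real n powr (1 - \<beta>)
      = typical_height \<beta> (n + 1 - i) / typical_height \<beta> n"
    using eventually_ge_at_top[of i]
    by eventually_elim (use \<beta> in \<open>simp add: typical_height_def of_nat_diff\<close>)
  ultimately show ?thesis by (rule Lim_transform_eventually)
qed

text \<open>Typical heights of neighbouring vertices have ratio tending to 1, so half of the tolerance pays for the change of the
  normalisation.\<close>

lemma height_concentration_shift:
  assumes "\<eta> > 0" "i \<ge> 1"
  shows "(\<lambda>n. prob {\<omega> \<in> space M. \<bar>height (n + 1 - i) \<omega> / typical_height \<beta> n - 1\<bar> > \<eta>}) \<longlonglongrightarrow> 0"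
proof (rule tendsto_sandwich[where f = "\<lambda>_. 0"])
  let ?g = "typical_height \<beta>"
  have "filterlim (\<lambda>n. n + 1 - i) at_top sequentially"
    by (rule filterlim_at_top_mono[OF filterlim_minus_const_nat_at_top[of i]])
      (auto intro!: always_eventually)
  moreover have "\<eta> / 2 > 0" using assms by simp
  ultimately show "(\<lambda>n. prob {\<omega> \<in> space M. \<bar>height (n + 1 - i) \<omega> / ?g (n + 1 - i) - 1\<bar> > \<eta> / 2}) \<longlonglongrightarrow> 0"
    by (intro filterlim_compose[OF height_concentration])
  have "\<forall>\<^sub>F n in sequentially. 1 - \<eta> / 2 < ?g (n + 1 - i) / ?g n"
    using typical_height_shift assms by (intro order_tendstoD[where y = 1]) auto
  then show "\<forall>\<^sub>F n in sequentially. prob {\<omega> \<in> space M. \<bar>height (n + 1 - i) \<omega> / ?g n - 1\<bar> > \<eta>}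
      \<le> prob {\<omega> \<in> space M. \<bar>height (n + 1 - i) \<omega> / ?g (n + 1 - i) - 1\<bar> > \<eta> / 2}"
    using eventually_ge_at_top[of "i + 1"]
  proof eventually_elim
    case (elim n)
    define r where "r = ?g (n + 1 - i) / ?g n"
    have g: "?g (n + 1 - i) > 0" "?g n > 0" using elim(2) \<beta> by (auto simp: typical_height_def)
    have r: "0 \<le> r" "r \<le> 1" "1 - \<eta> / 2 < r"
      using g elim typical_height_mono[of "n + 1 - i" n] assms by (auto simp: r_def)
    show ?case
    proof (rule finite_measure_mono)
      show "{\<omega> \<in> space M. \<bar>height (n + 1 - i) \<omega> / ?g n - 1\<bar> > \<eta>}
        \<subseteq> {\<omega> \<in> space M. \<bar>height (n + 1 - i) \<omega> / ?g (n + 1 - i) - 1\<bar> > \<eta> / 2}"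
      proof safe
        fix \<omega> assume *: "\<eta> < \<bar>height (n + 1 - i) \<omega> / ?g n - 1\<bar>"
        define x where "x = height (n + 1 - i) \<omega> / ?g (n + 1 - i)"
        have "height (n + 1 - i) \<omega> / ?g n = x * r" using g by (simp add: x_def r_def)
        also have "\<dots> - 1 = (x - 1) * r + (r - 1)" by (simp add: algebra_simps)
        finally have "\<eta> < \<bar>(x - 1) * r + (r - 1)\<bar>" using * by simp
        also have "\<dots> \<le> \<bar>x - 1\<bar> * r + \<bar>r - 1\<bar>"
          using r by (metis abs_mult abs_of_nonneg abs_triangle_ineq)
        also have "\<dots> \<le> \<bar>x - 1\<bar> * 1 + \<eta> / 2" using r by (intro add_mono mult_left_mono) auto
        finally show "\<eta> / 2 < \<bar>height (n + 1 - i) \<omega> / ?g (n + 1 - i) - 1\<bar>" by (simp add: x_def)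
      qed
    qed measurable
  qed
qed auto

abbreviation common :: "nat \<Rightarrow> nat \<Rightarrow> 'a \<Rightarrow> real" where
  "common u v \<omega> \<equiv> real (card (lineage (choices \<omega>) u \<inter> lineage (choices \<omega>) v))"

lemma measurable_common [measurable]: "common u v \<in> borel_measurable M"
  using measurable_lineage[of "\<lambda>A B. real (card (A \<inter> B))" u v] .

text \<open>The Markov inequality. As \<open>\<delta>\<close> is arbitrary, the mean number of common ancestors is of smaller order than \<open>g n\<close>.\<close>

lemma common_small:
  assumes "\<eta> > 0" "i \<ge> 1" "j \<ge> 1" "i \<noteq> j"
  shows "(\<lambda>n. prob {\<omega> \<in> space M. common (n + 1 - i) (n + 1 - j) \<omega> / typical_height \<beta> n > \<eta>}) \<longlonglongrightarrow> 0"
proof (rule tendstoI)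
  fix e :: real assume e: "e > 0"
  let ?g = "typical_height \<beta>"
  \<comment> \<open>The Markov bound tends to \<open>2 * \<delta> / \<eta>\<close>, which is \<open>e / 2\<close>.\<close>
  define \<delta> where "\<delta> = e * \<eta> / 4"
  have \<delta>: "\<delta> > 0" using e assms by (simp add: \<delta>_def)
  obtain K where K: "\<And>u v. u \<noteq> v \<Longrightarrow> common_mean u v \<le> \<delta> * (?g u + ?g v) + K"
    using common_mean_bound[OF \<delta>] by blast
  have "((\<lambda>x. (2 * \<delta> * x + K) / (x * \<eta>)) \<longlongrightarrow> 2 * \<delta> * inverse \<eta>) at_top"
    using assms by real_asymp
  then have "(\<lambda>n. (2 * \<delta> * ?g n + K) / (?g n * \<eta>)) \<longlonglongrightarrow> 2 * \<delta> * inverse \<eta>"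
    using filterlim_typical_height by (rule filterlim_compose)
  moreover have "2 * \<delta> * inverse \<eta> < e" using e assms by (simp add: \<delta>_def field_simps)
  ultimately have "\<forall>\<^sub>F n in sequentially. (2 * \<delta> * ?g n + K) / (?g n * \<eta>) < e"
    by (rule order_tendstoD)
  then show "\<forall>\<^sub>F n in sequentially. dist (prob {\<omega> \<in> space M. common (n + 1 - i) (n + 1 - j) \<omega> / ?g n > \<eta>}) 0 < e"
    using eventually_ge_at_top[of "i + j"]
  proof eventually_elim
    case (elim n)
    have g: "?g n > 0" using elim(2) \<beta> assms by (auto simp: typical_height_def)
    have ne: "n + 1 - i \<noteq> n + 1 - j" using elim(2) assms by linarith
    have "prob {\<omega> \<in> space M. common (n + 1 - i) (n + 1 - j) \<omega> / ?g n > \<eta>}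
        \<le> prob {\<omega> \<in> space M. common (n + 1 - i) (n + 1 - j) \<omega> \<ge> ?g n * \<eta>}"
    proof (rule finite_measure_mono)
      show "{\<omega> \<in> space M. common (n + 1 - i) (n + 1 - j) \<omega> / ?g n > \<eta>}
        \<subseteq> {\<omega> \<in> space M. common (n + 1 - i) (n + 1 - j) \<omega> \<ge> ?g n * \<eta>}"
        using g by (auto simp: field_simps)
    qed measurable
    also have "\<dots> \<le> common_mean (n + 1 - i) (n + 1 - j) / (?g n * \<eta>)"
      using g assms by (intro integral_Markov_inequality_measure[of _ _ "{}"] integrable_common) auto
    also have "\<dots> \<le> (2 * \<delta> * ?g n + K) / (?g n * \<eta>)"
    proof (rule divide_right_mono)
      have "\<delta> * (?g (n + 1 - i) + ?g (n + 1 - j)) \<le> \<delta> * (?g n + ?g n)"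
        using typical_height_mono[of "n + 1 - i" n] typical_height_mono[of "n + 1 - j" n] assms \<delta>
        by (intro mult_left_mono add_mono) auto
      with K[OF ne] show "common_mean (n + 1 - i) (n + 1 - j) \<le> 2 * \<delta> * ?g n + K" by simp
    qed (use g assms in simp)
    finally show ?case using elim(1) by simp
  qed
qed

text \<open>Measurability: the tree of size \<open>n\<close> is a function of finitely many choices. Convergence: outside a union
  of finitely many events whose probabilities tend to 0, one for each height and one for each pair of distinct vertices, and a
  null set on which a choice leaves its window, the deterministic comparison applies.\<close>

lemma GH_convergence:
  assumes k: "k \<ge> 1"
  shows "GH_tendsto_in_prob M
    (\<lambda>n \<omega>. scaled_graph_space ((1 - \<beta>) / 2 * real n powr (- (1 - \<beta>)))
      (spanned_subtree (recursive_tree (\<lambda>m. p m \<omega>) n)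
        (insert 1 {v \<in> {1..n}. n < v + k})))
    (star_space k)"
  unfolding GH_tendsto_in_prob_def
proof (intro conjI allI impI)
  let ?X = "\<lambda>n q. scaled_graph_space ((1 - \<beta>) / 2 * real n powr (- (1 - \<beta>)))
      (spanned_subtree (recursive_tree q n) (insert 1 {v \<in> {1..n}. n < v + k}))"
  have "depends_below n (\<lambda>q. gromov_hausdorff_dist (?X n q) (star_space k))" for n
    unfolding depends_below_def
  proof (intro allI impI)
    fix q q' :: "nat \<Rightarrow> nat" assume "\<forall>i\<in>{1..<n}. q i = q' i"
    then have "recursive_tree q n = recursive_tree q' n" by (intro recursive_tree_cong) auto
    then show "gromov_hausdorff_dist (?X n q) (star_space k) = gromov_hausdorff_dist (?X n q') (star_space k)"
      by (rule arg_cong)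
  qed
  then show meas: "(\<lambda>\<omega>. gromov_hausdorff_dist (?X n (choices \<omega>)) (star_space k)) \<in> borel_measurable M" for n
    by (rule measurable_depends_below) auto
  fix \<epsilon> :: real assume \<epsilon>: "\<epsilon> > 0"
  define \<eta> where "\<eta> = \<epsilon> / 2"
  have \<eta>: "\<eta> > 0" using \<epsilon> by (simp add: \<eta>_def)
  let ?g = "typical_height \<beta>"
  let ?I = "{(i, j). i \<in> {1..k} \<and> j \<in> {1..k} \<and> i \<noteq> j}"
  let ?H = "\<lambda>n i. {\<omega> \<in> space M. \<bar>height (n + 1 - i) \<omega> / ?g n - 1\<bar> > \<eta>}"
  let ?C = "\<lambda>n i j. {\<omega> \<in> space M. common (n + 1 - i) (n + 1 - j) \<omega> / ?g n > \<eta>}"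
  let ?bad = "\<lambda>n. (\<Sum>i\<in>{1..k}. prob (?H n i)) + (\<Sum>x\<in>?I. prob (?C n (fst x) (snd x)))"
  have fin: "finite ?I" by (rule finite_subset[of _ "{1..k} \<times> {1..k}"]) auto
  show "(\<lambda>n. prob {\<omega> \<in> space M. gromov_hausdorff_dist (?X n (choices \<omega>)) (star_space k) > ennreal \<epsilon>}) \<longlonglongrightarrow> 0"
  proof (rule tendsto_sandwich[where f = "\<lambda>_. 0"])
    have "?bad \<longlonglongrightarrow> (\<Sum>i\<in>{1..k}. 0) + (\<Sum>x\<in>?I. 0)"
    proof (intro tendsto_add tendsto_sum)
      show "(\<lambda>n. prob (?H n i)) \<longlonglongrightarrow> 0" if "i \<in> {1..k}" for i
        using \<eta> that by (intro height_concentration_shift) auto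
      show "(\<lambda>n. prob (?C n (fst x) (snd x))) \<longlonglongrightarrow> 0" if "x \<in> ?I" for x
        using \<eta> that by (intro common_small) auto
    qed
    then show "?bad \<longlonglongrightarrow> 0" by simp
    have "\<forall>\<^sub>F n in sequentially. 1 / \<eta> \<le> ?g n"
      using filterlim_typical_height by (simp add: filterlim_at_top)
    then show "\<forall>\<^sub>F n in sequentially.
      prob {\<omega> \<in> space M. gromov_hausdorff_dist (?X n (choices \<omega>)) (star_space k) > ennreal \<epsilon>} \<le> ?bad n"
      using eventually_ge_at_top[of k]
    proof eventually_elim
      case (elim n)
      have "prob {\<omega> \<in> space M. gromov_hausdorff_dist (?X n (choices \<omega>)) (star_space k) > ennreal \<epsilon>}
          \<le> prob ((\<Union>i\<in>{1..k}. ?H n i) \<union> (\<Union>x\<in>?I. ?C n (fst x) (snd x)))"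
      proof (rule finite_measure_mono_AE)
        show "AE \<omega> in M. \<omega> \<in> {\<omega> \<in> space M. gromov_hausdorff_dist (?X n (choices \<omega>)) (star_space k) > ennreal \<epsilon>}
            \<longrightarrow> \<omega> \<in> (\<Union>i\<in>{1..k}. ?H n i) \<union> (\<Union>x\<in>?I. ?C n (fst x) (snd x))"
          using AE_choices[of n]
        proof eventually_elim
          case choices: (elim \<omega>)
          show ?case
          proof (rule impI, rule ccontr)
            assume far: "\<omega> \<in> {\<omega> \<in> space M. gromov_hausdorff_dist (?X n (choices \<omega>)) (star_space k) > ennreal \<epsilon>}"
              and good: "\<omega> \<notin> (\<Union>i\<in>{1..k}. ?H n i) \<union> (\<Union>x\<in>?I. ?C n (fst x) (snd x))"
            have "gromov_hausdorff_dist (?X n (choices \<omega>)) (star_space k) \<le> ennreal (2 * \<eta>)"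
            proof (rule latest_vertices_close_to_star[OF \<beta>(2) k elim(2) \<eta> elim(1) choices])
              show "\<bar>height (n + 1 - i) \<omega> / ?g n - 1\<bar> \<le> \<eta>" if "i \<in> {1..k}" for i
              proof -
                have "\<omega> \<notin> ?H n i" using good that by blast
                then show ?thesis using far by (simp add: not_less)
              qed
              show "common (n + 1 - i) (n + 1 - j) \<omega> / ?g n \<le> \<eta>"
                if "i \<in> {1..k}" "j \<in> {1..k}" "i \<noteq> j" for i j
              proof -
                have "(i, j) \<in> ?I" using that by simp
                with good have "\<omega> \<notin> ?C n (fst (i, j)) (snd (i, j))" by blast
                then show ?thesis using far by (simp add: not_less)
              qed
            qed
            from leD[OF this] show False using far by (simp add: \<eta>_def)
          qed
        qed
        show "(\<Union>i\<in>{1..k}. ?H n i) \<union> (\<Union>x\<in>?I. ?C n (fst x) (snd x)) \<in> events"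
          using fin by (intro sets.Un sets.finite_UN) auto
      qed
      also have "\<dots> \<le> prob (\<Union>i\<in>{1..k}. ?H n i) + prob (\<Union>x\<in>?I. ?C n (fst x) (snd x))"
        by (rule measure_Un_le) (use fin in measurable)
      also have "\<dots> \<le> ?bad n"
        using fin by (intro add_mono measure_UNION_le) auto
      finally show ?case .
    qed
  qed auto
qed

end

theorem theorem2p10:
  fixes M :: "'a measure" and p :: "nat \<Rightarrow> 'a \<Rightarrow> nat" and \<beta> :: real and k :: nat
  assumes "1 / 2 < \<beta>" and "\<beta> < 1"
    and "limited_memory_process M (mesoscopic \<beta>) p"
    and "k \<ge> 1"
  shows "GH_tendsto_in_prob M
    (\<lambda>n \<omega>. scaled_graph_space ((1 - \<beta>) / 2 * real n powr (- (1 - \<beta>)))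
      (spanned_subtree (recursive_tree (\<lambda>m. p m \<omega>) n)
        (insert 1 {v \<in> {1..n}. n < v + k})))
    (star_space k)"
proof -
  interpret limited_memory_process M "mesoscopic \<beta>" p by fact
  interpret mesoscopic_tree M \<beta> p by unfold_locales (use assms in auto)
  show ?thesis using assms(4) by (rule GH_convergence)
qed

end
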